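(* Let $d\ge 3$ and let $X$ be the Lévy process in $\mathbb{R}^d$ with characteristic exponent $\Phi(\xi)=\frac{|\xi|^2}{\ln(1+|\xi|^2)}-1$. Let $G(x,y)=g(|x-y|)$ be its Green function. Then \[ g(r)\sim \frac{\Gamma(\frac d2-1)}{2\pi^{d/2}}\,r^{2-d}\ln\frac1r\quad\text{as } r\to0+, \qquad g(r)\sim \frac{\Gamma(\frac d2-1)}{2\pi^{d/2}}\,r^{2-d}\quad\text{as } r\to\infty. \]
   Context: $f\sim g$ means that the ratio tends to $1$ in the indicated limit; $\Gamma$ is the Gamma function. The characteristic exponent is given by $\mathbb{E}_x[e^{i\xi\cdot(X_t-X_0)}]=e^{-t\Phi(\xi)}$. The process $X$ is transient and has a transition density $p(t,x,y)$; its Green function is $G(x,y)=\int_0^\infty p(t,x,y)\,dt$, which depends only on $|x-y|$. Equivalently, $X_t=B_{S_t}$ where $B$ is a Brownian motion in $\mathbb{R}^d$ with $\mathbb{E}_x[e^{i\xi\cdot(B_t-B_0)}]=e^{-t|\xi|^2}$ and $S$ is an independent subordinator with Laplace exponent $\phi(\lambda)=\frac{\lambda}{\ln(1+\lambda)}-1$ (i.e. $\mathbb{E}e^{-\lambda S_t}=e^{-t\phi(\lambda)}$), and \[ g(r)=(4\pi)^{-d/2}\int_{(0,\infty)}t^{-d/2}e^{-r^2/(4t)}\,U(dt),\qquad r>0, \] where $U(A)=\mathbb{E}\left[\int_0^\infty 1_{\{S_t\in A\}}\,dt\right]$ is the potential measure of $S$. *)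

theory Defs
  imports "HOL-Probability.Probability" "HOL-Library.Landau_Symbols"
begin

text \<open>
  Levy processes in the Euclidean space \<^typ>\<open>'a\<close>, of dimension \<open>DIM('a)\<close>, started at the origin;
  only times \<open>t \<ge> 0\<close> are used. The process under the law \<open>P\<^sub>x\<close> is \<open>x + X\<close>.
\<close>

definition levy_process :: "'w measure \<Rightarrow> (real \<Rightarrow> 'w \<Rightarrow> 'a::euclidean_space) \<Rightarrow> bool" where
  "levy_process M X \<longleftrightarrow>
     prob_space M \<and>
     (\<forall>t\<ge>0. X t \<in> borel_measurable M) \<and>
     (AE \<omega> in M. X 0 \<omega> = 0) \<and>
     (\<forall>(n::nat) (\<tau>::nat \<Rightarrow> real). 0 \<le> \<tau> 0 \<and> (\<forall>i<n. \<tau> i \<le> \<tau> (Suc i)) \<longrightarrow>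
        prob_space.indep_vars M (\<lambda>_. borel) (\<lambda>i \<omega>. X (\<tau> (Suc i)) \<omega> - X (\<tau> i) \<omega>) {..<n}) \<and>
     (\<forall>s\<ge>0. \<forall>t\<ge>0. distr M borel (\<lambda>\<omega>. X (s + t) \<omega> - X s \<omega>) = distr M borel (\<lambda>\<omega>. X t \<omega> - X 0 \<omega>)) \<and>
     (AE \<omega> in M. \<forall>t\<ge>0. continuous (at_right t) (\<lambda>s. X s \<omega>) \<and>
        (t > 0 \<longrightarrow> (\<exists>l. ((\<lambda>s. X s \<omega>) \<longlongrightarrow> l) (at_left t))))"

definition has_char_exponent ::
    "'w measure \<Rightarrow> (real \<Rightarrow> 'w \<Rightarrow> 'a::euclidean_space) \<Rightarrow> ('a \<Rightarrow> complex) \<Rightarrow> bool" where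
  "has_char_exponent M X \<Phi> \<longleftrightarrow>
     (\<forall>t\<ge>0. \<forall>\<xi>. (CLINT \<omega>|M. iexp (\<xi> \<bullet> (X t \<omega> - X 0 \<omega>))) = exp (- (of_real t * \<Phi> \<xi>)))"

text \<open>
  The quotient is extended continuously to \<open>\<xi> = 0\<close>, where its limit is \<open>1\<close>; with the convention
  \<open>x / 0 = 0\<close> the bare formula would give \<open>-1\<close> instead of \<open>0\<close> at the origin.
\<close>

definition log_exponent :: "'a::euclidean_space \<Rightarrow> real" where
  "log_exponent \<xi> = (if \<xi> = 0 then 0 else (norm \<xi>)\<^sup>2 / ln (1 + (norm \<xi>)\<^sup>2) - 1)"

text \<open>
  Being a density determines \<open>p t x\<close> only almost everywhere, whereas pointwise values of the Green
  function are at stake. Continuity in the space variable singles out the canonical version.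
\<close>

definition transition_density ::
    "'w measure \<Rightarrow> (real \<Rightarrow> 'w \<Rightarrow> 'a::euclidean_space) \<Rightarrow> (real \<Rightarrow> 'a \<Rightarrow> 'a \<Rightarrow> real) \<Rightarrow> bool" where
  "transition_density M X p \<longleftrightarrow>
     (\<forall>t>0. \<forall>x. (\<forall>y. 0 \<le> p t x y) \<and> continuous_on UNIV (p t x) \<and>
        distributed M lborel (\<lambda>\<omega>. x + X t \<omega>) (\<lambda>y. ennreal (p t x y)))"

definition green_function :: "(real \<Rightarrow> 'a \<Rightarrow> 'a \<Rightarrow> real) \<Rightarrow> 'a \<Rightarrow> 'a \<Rightarrow> ennreal" where
  "green_function p x y = (\<integral>\<^sup>+ t\<in>{0<..}. ennreal (p t x y) \<partial>lborel)"

end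

theory Submission
  imports Defs "HOL-Real_Asymp.Real_Asymp"
begin

text \<open>
  Put \<open>\<phi> q = q / ln (1 + q) - 1\<close> and \<open>w q = ln (1 + q) / q\<close>. Since \<open>w < 1\<close> and \<open>w\<close> is the Laplace
  transform of the exponential integral \<open>E\<^sub>1\<close>, the identity \<open>1 / \<phi> = w / (1 - w) = \<Sum>n\<ge>1. w ^ n\<close> exhibits
  \<open>1 / \<phi>\<close> as the Laplace transform of a nonnegative function, the renewal density of \<open>E\<^sub>1\<close>; it is the
  density of the potential measure \<open>U\<close>, so the subordinator itself is never needed.

  The formula \<open>G(0, y) = \<integral> (4 \<pi> t) powr (- d / 2) * exp (- |y|\<^sup>2 / (4 t)) U(dt)\<close> is obtained on the Fourier side.
  Regularising either by a Gaussian of variance \<open>2 s\<close> or by starting the time integral at \<open>\<epsilon>\<close>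
  makes all integrals absolutely convergent, and Fatou's lemma for \<open>s \<rightarrow> 0\<close> and for \<open>\<epsilon> \<rightarrow> 0\<close> yields
  the two inequalities. The asymptotics follow from Karamata's Tauberian argument applied to the
  measures \<open>U\<close> rescaled by \<open>r\<^sup>2\<close>, because \<open>\<phi> (q x) / \<phi> x \<rightarrow> q\<close> for \<open>x \<rightarrow> 0\<close> and for \<open>x \<rightarrow> \<infinity>\<close>.
\<close>

section \<open>The potential density\<close>

text \<open>The Fourier integral of \<open>1 / log_exponent\<close> is not absolutely convergent:
  near the origin it behaves like \<open>2 / |\<xi>|\<^sup>2\<close>, which is integrable because
  \<open>d \<ge> 3\<close>, but at infinity it decays only like
  \<open>ln (|\<xi>|\<^sup>2) / |\<xi>|\<^sup>2\<close>. Hence the regularisations. Each turns the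
  formula into an exact identity, but on one side the limit is taken by Fatou's lemma, so each
  yields one inequality. Fatou's lemma wants nonnegative integrands, and the sign of a cosine
  integral is invisible on the Fourier side; it comes from reading these integrals as expectations
  of heat kernels along the process.

  The constants: the rescaled measures tend to Lebesgue measure on the half-line, whose Gaussian
  mixture at distance 1 is \<open>Gamma (d / 2 - 1) / (4 * pi powr (d / 2))\<close>. The missing
  factor 2 has a different source in each regime: \<open>\<phi> x\<close> is asymptotic to
  \<open>x / 2\<close> at 0, and to \<open>x / ln x\<close> at infinity, where
  \<open>ln (1 / r\<^sup>2) = 2 * ln (1 / r)\<close> also brings in the logarithm.\<close>

definition \<phi> :: "real \<Rightarrow> real" where
  "\<phi> q = q / ln (1 + q) - 1"

text \<open>Intended for functions that vanish for \<open>t \<le> 0\<close>. Integrating over the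
  whole line keeps translations, and hence convolutions, free of domain conditions.\<close>

definition laplace :: "(real \<Rightarrow> ennreal) \<Rightarrow> real \<Rightarrow> ennreal" where
  "laplace f q = (\<integral>\<^sup>+t. f t * ennreal (exp (- (q * t))) \<partial>lborel)"

section \<open>The exponential integral and its Laplace transform\<close>

lemma nn_integral_exp_atLeast:
  assumes "c > (0::real)"
  shows "(\<integral>\<^sup>+t. ennreal (exp (- (c * t))) * indicator {s..} t \<partial>lborel) = ennreal (exp (- (c * s)) / c)"
proof -
  have "((\<lambda>t. - exp (- (c * t)) / c) \<longlongrightarrow> 0) at_top"
    using assms by real_asymp
  then have "(\<integral>\<^sup>+t. ennreal (exp (- (c * t))) * indicator {s..} t \<partial>lborel) = ennreal (0 - (- exp (- (c * s)) / c))"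
    using assms by (intro nn_integral_FTC_atLeast) (auto intro!: derivative_eq_intros)
  then show ?thesis by simp
qed

lemma nn_integral_exp_pos:
  assumes "c > (0::real)"
  shows "(\<integral>\<^sup>+t. indicator {0<..} t * ennreal (exp (- (c * t))) \<partial>lborel) = ennreal (1 / c)"
proof -
  have "(\<integral>\<^sup>+t. indicator {0<..} t * ennreal (exp (- (c * t))) \<partial>lborel) =
        (\<integral>\<^sup>+t. ennreal (exp (- (c * t))) * indicator {0..} t \<partial>lborel)"
    using AE_lborel_singleton[of "0::real"]
    by (intro nn_integral_cong_AE) (auto split: split_indicator)
  then show ?thesis using nn_integral_exp_atLeast[OF assms, of 0] by simp
qed

text \<open>The substitution \<open>u = t * y\<close> gives the usual exponential integral of
  \<open>exp (- u) / u\<close> over \<open>u \<ge> t\<close>. In this form \<open>t\<close> occurs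
  only in the exponent, which suits Tonelli's theorem.\<close>

definition E1 :: "real \<Rightarrow> ennreal" where
  "E1 t = (\<integral>\<^sup>+y. ennreal (exp (- (t * y)) / y) * indicator {1..} y \<partial>lborel) * indicator {0<..} t"

lemma measurable_E1 [measurable]: "E1 \<in> borel_measurable borel"
  unfolding E1_def[abs_def] by measurable

text \<open>Tonelli: integrating over \<open>t\<close> first gives \<open>1 / (y + q)\<close>, and
  what remains is the integral of \<open>1 / (y * (y + q))\<close> over \<open>y \<ge> 1\<close>,
  done by partial fractions.\<close>

lemma laplace_E1:
  assumes "q > 0"
  shows "laplace E1 q = ennreal (ln (1 + q) / q)"
proof -
  have "laplace E1 q = (\<integral>\<^sup>+t. \<integral>\<^sup>+y. ennreal (exp (- (t * y)) / y) * indicator {1..} y *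
            (indicator {0<..} t * ennreal (exp (- (q * t)))) \<partial>lborel \<partial>lborel)"
    unfolding laplace_def E1_def
    by (intro nn_integral_cong, subst nn_integral_multc) (auto simp: mult_ac)
  also have "\<dots> = (\<integral>\<^sup>+y. \<integral>\<^sup>+t. ennreal (exp (- (t * y)) / y) * indicator {1..} y *
            (indicator {0<..} t * ennreal (exp (- (q * t)))) \<partial>lborel \<partial>lborel)"
    by (rule lborel_pair.Fubini') measurable
  also have "\<dots> = (\<integral>\<^sup>+y. \<integral>\<^sup>+t. ennreal (1 / y) * indicator {1..} y *
            (indicator {0<..} t * ennreal (exp (- ((y + q) * t)))) \<partial>lborel \<partial>lborel)"
    by (intro nn_integral_cong)
       (auto split: split_indicator simp: ennreal_mult'[symmetric] exp_add[symmetric] algebra_simps exp_minus field_simps)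
  also have "\<dots> = (\<integral>\<^sup>+y. ennreal (1 / y) * indicator {1..} y * ennreal (1 / (y + q)) \<partial>lborel)"
  proof (intro nn_integral_cong)
    fix y :: real
    show "(\<integral>\<^sup>+t. ennreal (1 / y) * indicator {1..} y * (indicator {0<..} t * ennreal (exp (- ((y + q) * t)))) \<partial>lborel)
       = ennreal (1 / y) * indicator {1..} y * ennreal (1 / (y + q))"
      using assms by (cases "y \<ge> 1", subst nn_integral_cmult, simp, subst nn_integral_exp_pos) auto
  qed
  also have "\<dots> = (\<integral>\<^sup>+y. ennreal (1 / (y * (y + q))) * indicator {1..} y \<partial>lborel)"
    using assms by (intro nn_integral_cong) (auto split: split_indicator simp: ennreal_mult'[symmetric])
  also have "\<dots> = ennreal (0 - ((ln 1 - ln (1 + q)) / q))"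
  proof (rule nn_integral_FTC_atLeast)
    show "((\<lambda>y. (ln y - ln (y + q)) / q) \<longlongrightarrow> 0) at_top"
      using assms by real_asymp
    show "((\<lambda>y. (ln y - ln (y + q)) / q) has_real_derivative 1 / (x * (x + q))) (at x)" if "1 \<le> x" for x
    proof -
      have "(1 / x - 1 / (x + q)) / q = 1 / (x * (x + q))"
        using that assms by (simp add: divide_simps)
      then show ?thesis
        using that assms by (auto intro!: derivative_eq_intros)
    qed
  qed (use assms in auto)
  finally show ?thesis by simp
qed

section \<open>Convolution powers and the renewal series\<close>

definition conv :: "(real \<Rightarrow> ennreal) \<Rightarrow> (real \<Rightarrow> ennreal) \<Rightarrow> real \<Rightarrow> ennreal" where
  "conv f g x = (\<integral>\<^sup>+y. f (x - y) * g y \<partial>lborel)"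

lemma measurable_conv [measurable (raw)]:
  assumes [measurable]: "f \<in> borel_measurable borel" "g \<in> borel_measurable borel"
  shows "conv f g \<in> borel_measurable borel"
  unfolding conv_def[abs_def] by measurable

lemma laplace_conv:
  assumes [measurable]: "f \<in> borel_measurable borel" "g \<in> borel_measurable borel"
  shows "laplace (conv f g) q = laplace f q * laplace g q"
proof -
  have "laplace (conv f g) q = (\<integral>\<^sup>+x. \<integral>\<^sup>+y. f (x - y) * g y * ennreal (exp (- (q * x))) \<partial>lborel \<partial>lborel)"
    unfolding laplace_def conv_def by (intro nn_integral_cong) (simp add: nn_integral_multc)
  also have "\<dots> = (\<integral>\<^sup>+y. \<integral>\<^sup>+x. f (x - y) * g y * ennreal (exp (- (q * x))) \<partial>lborel \<partial>lborel)"
    by (rule lborel_pair.Fubini') measurable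
  also have "\<dots> = (\<integral>\<^sup>+y. \<integral>\<^sup>+x. f x * g y * ennreal (exp (- (q * (y + x)))) \<partial>lborel \<partial>lborel)"
  proof (rule nn_integral_cong)
    fix y :: real
    show "(\<integral>\<^sup>+x. f (x - y) * g y * ennreal (exp (- (q * x))) \<partial>lborel) =
          (\<integral>\<^sup>+x. f x * g y * ennreal (exp (- (q * (y + x)))) \<partial>lborel)"
      by (subst nn_integral_real_affine[where c=1 and t=y]) auto
  qed
  also have "\<dots> = (\<integral>\<^sup>+y. laplace f q * (g y * ennreal (exp (- (q * y)))) \<partial>lborel)"
    unfolding laplace_def
    by (intro nn_integral_cong, subst nn_integral_multc[symmetric])
       (auto intro!: nn_integral_cong simp: ennreal_mult'[symmetric] exp_add[symmetric] algebra_simps)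
  also have "\<dots> = laplace f q * laplace g q"
    unfolding laplace_def[of g] by (rule nn_integral_cmult) measurable
  finally show ?thesis .
qed

lemma conv_nonpos_eq_0:
  assumes "\<And>t. t \<le> 0 \<Longrightarrow> f t = 0" "\<And>t. t \<le> 0 \<Longrightarrow> g t = 0" "x \<le> 0"
  shows "conv f g x = 0"
proof -
  have "f (x - y) * g y = 0" for y
    using assms(1)[of "x - y"] assms(2)[of y] assms(3) by (cases "y \<le> 0") auto
  then show ?thesis unfolding conv_def by (simp only: nn_integral_const mult_zero_left)
qed

text \<open>Index \<open>n\<close> stands for the convolution power \<open>n + 1\<close>. The zeroth
  power would be a unit mass at 0, which has no density, and the series for
  \<open>1 / \<phi>\<close> starts with the first power.\<close>

primrec E1_pow :: "nat \<Rightarrow> real \<Rightarrow> ennreal" where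
  "E1_pow 0 = E1"
| "E1_pow (Suc n) = conv E1 (E1_pow n)"

lemma measurable_E1_pow [measurable]: "E1_pow n \<in> borel_measurable borel"
  by (induction n) auto

lemma E1_pow_nonpos: "t \<le> 0 \<Longrightarrow> E1_pow n t = 0"
proof (induction n arbitrary: t)
  case (Suc n)
  then show ?case using conv_nonpos_eq_0[of E1 "E1_pow n" t] by (auto simp: E1_def)
qed (auto simp: E1_def)

lemma laplace_E1_pow:
  assumes "q > 0"
  shows "laplace (E1_pow n) q = ennreal ((ln (1 + q) / q) ^ Suc n)"
  using assms by (induction n) (auto simp: laplace_E1 laplace_conv ennreal_mult'[symmetric])

lemma phi_pos: "q > 0 \<Longrightarrow> \<phi> q > 0"
  using ln_add_one_self_less_self[of q] by (simp add: \<phi>_def field_simps)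

definition renewal_density :: "real \<Rightarrow> ennreal" where
  "renewal_density t = (\<Sum>n. E1_pow n t)"

lemma measurable_renewal_density [measurable]: "renewal_density \<in> borel_measurable borel"
  unfolding renewal_density_def[abs_def] by measurable

lemma renewal_density_nonpos: "t \<le> 0 \<Longrightarrow> renewal_density t = 0"
  by (simp add: renewal_density_def E1_pow_nonpos)

lemma laplace_renewal_density:
  assumes "q > 0"
  shows "laplace renewal_density q = ennreal (1 / \<phi> q)"
proof -
  define w where "w = ln (1 + q) / q"
  have w: "0 < w" "w < 1"
    using ln_add_one_self_less_self[OF assms] assms by (auto simp: w_def)
  have "laplace renewal_density q = (\<Sum>n. laplace (E1_pow n) q)"
    unfolding laplace_def renewal_density_def ennreal_suminf_multc[symmetric]
    by (rule nn_integral_suminf) measurable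
  also have "\<dots> = (\<Sum>n. ennreal (w * w ^ n))"
    using assms by (simp add: laplace_E1_pow w_def)
  also have "\<dots> = ennreal (w * (1 / (1 - w)))"
    using w geometric_sums[of w] by (intro suminf_ennreal_eq sums_mult) auto
  also have "w * (1 / (1 - w)) = 1 / \<phi> q"
    using assms w ln_add_one_self_less_self[OF assms] by (simp add: \<phi>_def w_def field_simps)
  finally show ?thesis .
qed

text \<open>The reciprocal \<open>1 / \<phi>\<close> is the Laplace transform of a nonnegative
  function on the positive half-line, hence decreasing.\<close>

lemma phi_mono:
  assumes "0 < a" "a \<le> b"
  shows "\<phi> a \<le> \<phi> b"
proof -
  have "laplace renewal_density b \<le> laplace renewal_density a"
    unfolding laplace_def
  proof (intro nn_integral_mono)
    fix t show "renewal_density t * ennreal (exp (- (b * t))) \<le> renewal_density t * ennreal (exp (- (a * t)))"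
      using assms by (cases "t \<le> 0") (auto simp: renewal_density_nonpos intro!: mult_left_mono ennreal_leI)
  qed
  then show ?thesis
    using assms phi_pos[of a] phi_pos[of b] by (simp add: laplace_renewal_density field_simps)
qed

text \<open>Here \<open>\<phi> x / x = 1 / ln (1 + x) - 1 / x\<close>, and its derivative is
  nonpositive iff \<open>(1 + x) * (ln (1 + x))\<^sup>2 \<le> x\<^sup>2\<close>. With
  \<open>y = ln (1 + x) / 2\<close> this is the square of
  \<open>2 * y * exp y \<le> exp (2 * y) - 1\<close>, that is,
  \<open>y \<le> sinh y\<close>.\<close>

lemma phi_div_antimono:
  assumes "0 < a" "a \<le> b"
  shows "\<phi> b / b \<le> \<phi> a / a"
proof -
  have ln_le: "(1 + x) * (ln (1 + x))\<^sup>2 \<le> x\<^sup>2" if "x > 0" for x :: real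
  proof -
    define y where "y = ln (1 + x) / 2"
    have y: "y \<ge> 0" using that by (simp add: y_def)
    have ex: "exp y ^ 2 = 1 + x"
      using that by (simp add: y_def exp_double[symmetric])
    have "2 * y * exp y \<le> (exp y - inverse (exp y)) * exp y"
      using real_le_x_sinh[OF y] by (intro mult_right_mono) auto
    also have "\<dots> = x" using ex by (simp add: algebra_simps power2_eq_square)
    finally have "(2 * y * exp y)\<^sup>2 \<le> x\<^sup>2"
      using y by (intro power_mono) auto
    then show ?thesis using ex by (simp add: power_mult_distrib y_def mult_ac)
  qed
  have "(\<lambda>x. 1 / ln (1 + x) - 1 / x) b \<le> (\<lambda>x. 1 / ln (1 + x) - 1 / x) a"
  proof (rule DERIV_nonpos_imp_nonincreasing[OF assms(2)])
    fix x assume "a \<le> x" "x \<le> b"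
    then have x: "x > 0" using assms by auto
    then have l: "ln (1 + x) > 0" by simp
    show "\<exists>y. ((\<lambda>x. 1 / ln (1 + x) - 1 / x) has_real_derivative y) (at x) \<and> y \<le> 0"
    proof (intro exI conjI)
      show "((\<lambda>x. 1 / ln (1 + x) - 1 / x) has_real_derivative (1 / x\<^sup>2 - 1 / ((1 + x) * (ln (1 + x))\<^sup>2))) (at x)"
        using x l by (auto intro!: derivative_eq_intros simp: field_simps power2_eq_square)
      show "1 / x\<^sup>2 - 1 / ((1 + x) * (ln (1 + x))\<^sup>2) \<le> 0"
        using ln_le[OF x] x l by (simp add: frac_le)
    qed
  qed
  moreover have "\<phi> x / x = 1 / ln (1 + x) - 1 / x" if "x > 0" for x
    using that by (simp add: \<phi>_def field_simps)
  ultimately show ?thesis using assms by simp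
qed

text \<open>Monotonicity of \<open>\<phi>\<close> gives the bound 1 for \<open>l \<ge> 1\<close>,
  monotonicity of \<open>\<phi> x / x\<close> gives \<open>1 / l\<close> for \<open>l < 1\<close>.
  The sum covers both cases and does not depend on \<open>a\<close>, so it dominates the rescaled
  Laplace transforms at all scales at once.\<close>

lemma phi_ratio_bound:
  assumes "0 < a" "0 < l"
  shows "\<phi> a / \<phi> (l * a) \<le> 1 + 1 / l"
proof (cases "l \<ge> 1")
  case True
  then have "\<phi> a \<le> \<phi> (l * a)" using assms by (intro phi_mono) auto
  then have "\<phi> a / \<phi> (l * a) \<le> 1" using phi_pos[of "l * a"] assms by (simp add: field_simps)
  then show ?thesis using assms by (smt (verit) divide_pos_pos)
next
  case False
  then have "\<phi> a / a \<le> \<phi> (l * a) / (l * a)" using assms by (intro phi_div_antimono) auto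
  then have "\<phi> a / \<phi> (l * a) \<le> 1 / l" using phi_pos[of "l * a"] assms by (simp add: field_simps)
  then show ?thesis by simp
qed

text \<open>Makes \<open>log_exponent\<close> grow at least linearly in \<open>norm \<xi>\<close>,
  so that \<open>exp (- (t * log_exponent \<xi>))\<close> is integrable for every
  \<open>t > 0\<close>. The inequality behind it is \<open>ln (1 + x\<^sup>2) \<le> x\<close>, where
  the derivative of the difference is \<open>(1 - x)\<^sup>2 / (1 + x\<^sup>2)\<close>.\<close>

lemma phi_ge_sqrt:
  assumes "x > 0"
  shows "\<phi> (x\<^sup>2) \<ge> x - 1"
proof -
  have "(\<lambda>x. x - ln (1 + x\<^sup>2)) 0 \<le> (\<lambda>x. x - ln (1 + x\<^sup>2)) x"
  proof (rule DERIV_nonneg_imp_nondecreasing[OF less_imp_le[OF assms]])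
    fix t :: real
    have "1 + t\<^sup>2 > 0" by (simp add: add_pos_nonneg)
    moreover have "(t - 1)\<^sup>2 \<ge> 0" by simp
    then have "2 * t \<le> 1 + t\<^sup>2" by (simp add: power2_eq_square algebra_simps)
    ultimately show "\<exists>y. ((\<lambda>x. x - ln (1 + x\<^sup>2)) has_real_derivative y) (at t) \<and> 0 \<le> y"
      by (intro exI[of _ "1 - 2 * t / (1 + t\<^sup>2)"]) (auto intro!: derivative_eq_intros simp: field_simps)
  qed
  then have "ln (1 + x\<^sup>2) \<le> x" by simp
  moreover have "ln (1 + x\<^sup>2) > 0" using assms by (intro ln_gt_zero) simp
  ultimately have "x\<^sup>2 / ln (1 + x\<^sup>2) \<ge> x\<^sup>2 / x" using assms by (intro divide_left_mono) auto
  then show ?thesis using assms by (simp add: \<phi>_def power2_eq_square)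
qed

section \<open>A Tauberian theorem\<close>

lemma phi_ratio_at_top:
  assumes "l > 0"
  shows "((\<lambda>x. \<phi> x / \<phi> (l * x)) \<longlongrightarrow> 1 / l) at_top"
proof -
  have "((\<lambda>x. \<phi> x / \<phi> (l * x)) \<longlongrightarrow> inverse l) at_top"
    unfolding \<phi>_def using assms by real_asymp
  then show ?thesis by (simp add: inverse_eq_divide)
qed

lemma phi_ratio_at_right_0:
  assumes "l > 0"
  shows "((\<lambda>x. \<phi> x / \<phi> (l * x)) \<longlongrightarrow> 1 / l) (at_right 0)"
proof -
  have "((\<lambda>x. \<phi> x / \<phi> (l * x)) \<longlongrightarrow> 1 / (l * (inverse l * (inverse l * (l * l))))) (at_right 0)"
    unfolding \<phi>_def using assms by real_asymp
  moreover have "1 / (l * (inverse l * (inverse l * (l * l)))) = 1 / l"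
    using assms by (simp add: field_simps)
  ultimately show ?thesis by (simp only:)
qed

lemma nn_integral_Gamma_scaled:
  assumes "a > 0" "c > (0::real)"
  shows "(\<integral>\<^sup>+q. ennreal (q powr (a - 1) * exp (- (c * q))) * indicator {0<..} q \<partial>lborel)
         = ennreal (Gamma a * c powr (- a))"
proof -
  have "ennreal (Gamma a) = (\<integral>\<^sup>+t. ennreal (indicator {0..} t * t powr (a - 1) / exp t) \<partial>lborel)"
    using assms by (intro Gamma_conv_nn_integral_real)
  also have "\<dots> = ennreal c * (\<integral>\<^sup>+q. ennreal (indicator {0..} (c * q) * (c * q) powr (a - 1) / exp (c * q)) \<partial>lborel)"
    using assms by (subst nn_integral_real_affine[where c=c and t=0]) auto
  also have "(\<integral>\<^sup>+q. ennreal (indicator {0..} (c * q) * (c * q) powr (a - 1) / exp (c * q)) \<partial>lborel) =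
      (\<integral>\<^sup>+q. ennreal (c powr (a - 1)) * (ennreal (q powr (a - 1) * exp (- (c * q))) * indicator {0<..} q) \<partial>lborel)"
    using assms
    by (intro nn_integral_cong)
       (auto split: split_indicator simp: powr_mult exp_minus field_simps ennreal_mult'[symmetric] zero_le_mult_iff)
  also have "\<dots> = ennreal (c powr (a - 1)) * (\<integral>\<^sup>+q. ennreal (q powr (a - 1) * exp (- (c * q))) * indicator {0<..} q \<partial>lborel)"
    by (intro nn_integral_cmult) measurable
  finally have "ennreal (Gamma a) = ennreal (c powr a) * (\<integral>\<^sup>+q. ennreal (q powr (a - 1) * exp (- (c * q))) * indicator {0<..} q \<partial>lborel)"
    using assms by (simp add: mult.assoc[symmetric] ennreal_mult'[symmetric] powr_diff)
  then have "ennreal (c powr (-a)) * ennreal (Gamma a) =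
     (ennreal (c powr (-a)) * ennreal (c powr a)) * (\<integral>\<^sup>+q. ennreal (q powr (a - 1) * exp (- (c * q))) * indicator {0<..} q \<partial>lborel)"
    by (simp only: mult.assoc)
  then show ?thesis
    using assms by (simp add: ennreal_mult'[symmetric] powr_minus mult.commute)
qed

section \<open>Polynomial weights as mixtures of exponentials\<close>

lemma measurable_laplace [measurable]:
  assumes [measurable]: "f \<in> borel_measurable borel"
  shows "laplace f \<in> borel_measurable borel"
  unfolding laplace_def[abs_def] by measurable

text \<open>Insert \<open>Gamma a * (1 + t) powr (- a)\<close> as the Gamma integral with rate
  \<open>1 + t\<close> and apply Tonelli. A weighted integral of \<open>f\<close> thus becomes an
  average of \<open>laplace f\<close>, so bounds and limits of Laplace transforms carry over to
  it.\<close>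

lemma nn_integral_powr_weight:
  assumes [measurable]: "f \<in> borel_measurable borel"
    and pos: "\<And>t. t \<le> 0 \<Longrightarrow> f t = 0" and a: "a > 0"
  shows "ennreal (Gamma a) * (\<integral>\<^sup>+t. f t * ennreal ((1 + t) powr (- a) * exp (- (k * t))) \<partial>lborel) =
    (\<integral>\<^sup>+q. ennreal (q powr (a - 1) * exp (- q)) * indicator {0<..} q * laplace f (q + k) \<partial>lborel)"
proof -
  have "ennreal (Gamma a) * (\<integral>\<^sup>+t. f t * ennreal ((1 + t) powr (- a) * exp (- (k * t))) \<partial>lborel) =
     (\<integral>\<^sup>+t. ennreal (Gamma a) * (f t * ennreal ((1 + t) powr (- a) * exp (- (k * t)))) \<partial>lborel)"
    by (rule nn_integral_cmult[symmetric]) measurable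
  also have "\<dots> = (\<integral>\<^sup>+t. \<integral>\<^sup>+q. (f t * ennreal (exp (- (k * t)))) *
          (ennreal (q powr (a - 1) * exp (- ((1 + t) * q))) * indicator {0<..} q) \<partial>lborel \<partial>lborel)"
  proof (rule nn_integral_cong)
    fix t :: real
    show "ennreal (Gamma a) * (f t * ennreal ((1 + t) powr (- a) * exp (- (k * t)))) =
      (\<integral>\<^sup>+q. (f t * ennreal (exp (- (k * t)))) *
          (ennreal (q powr (a - 1) * exp (- ((1 + t) * q))) * indicator {0<..} q) \<partial>lborel)"
    proof (cases "t \<le> 0")
      case True
      then show ?thesis by (simp add: pos)
    next
      case False
      have "(\<integral>\<^sup>+q. (f t * ennreal (exp (- (k * t)))) *
          (ennreal (q powr (a - 1) * exp (- ((1 + t) * q))) * indicator {0<..} q) \<partial>lborel) =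
        (f t * ennreal (exp (- (k * t)))) * ennreal (Gamma a * (1 + t) powr (- a))"
        using False a by (subst nn_integral_cmult) (auto simp: nn_integral_Gamma_scaled)
      then show ?thesis using a by (simp add: ennreal_mult'' mult_ac Gamma_real_nonneg)
    qed
  qed
  also have "\<dots> = (\<integral>\<^sup>+q. \<integral>\<^sup>+t. (f t * ennreal (exp (- (k * t)))) *
          (ennreal (q powr (a - 1) * exp (- ((1 + t) * q))) * indicator {0<..} q) \<partial>lborel \<partial>lborel)"
    by (rule lborel_pair.Fubini') measurable
  also have "\<dots> = (\<integral>\<^sup>+q. ennreal (q powr (a - 1) * exp (- q)) * indicator {0<..} q * laplace f (q + k) \<partial>lborel)"
    unfolding laplace_def
  proof (rule nn_integral_cong)
    fix q :: real
    show "(\<integral>\<^sup>+t. (f t * ennreal (exp (- (k * t)))) *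
          (ennreal (q powr (a - 1) * exp (- ((1 + t) * q))) * indicator {0<..} q) \<partial>lborel) =
       ennreal (q powr (a - 1) * exp (- q)) * indicator {0<..} q * (\<integral>\<^sup>+t. f t * ennreal (exp (- ((q + k) * t))) \<partial>lborel)"
    proof -
      have "f t * ennreal (exp (- (k * t))) * (ennreal (q powr (a - 1) * exp (- ((1 + t) * q))) * indicator {0<..} q) =
          ennreal (q powr (a - 1) * exp (- q)) * indicator {0<..} q * (f t * ennreal (exp (- ((q + k) * t))))" for t
      proof -
        have "exp (- (k * t)) * exp (- ((1 + t) * q)) = exp (- q) * exp (- ((q + k) * t))"
          unfolding exp_add[symmetric] by (simp add: algebra_simps)
        then have "ennreal (exp (- (k * t))) * ennreal (exp (- ((1 + t) * q))) = ennreal (exp (- q)) * ennreal (exp (- ((q + k) * t)))"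
          by (simp only: ennreal_mult''[symmetric] exp_ge_zero)
        then show ?thesis
          by (simp add: ennreal_mult'' mult_ac)
      qed
      then show ?thesis by (subst nn_integral_cmult[symmetric]) auto
    qed
  qed
  finally show ?thesis .
qed

text \<open>The summand \<open>1 / q\<close> lowers the power to \<open>q powr (a - 2)\<close>,
  integrable at 0 precisely for \<open>a > 1\<close>. With \<open>a = d / 2\<close> this is the
  condition \<open>d \<ge> 3\<close>.\<close>

lemma nn_integral_Gamma_bound_finite:
  assumes "a > (1::real)"
  shows "(\<integral>\<^sup>+q. ennreal (q powr (a - 1) * exp (- q)) * indicator {0<..} q * ennreal (1 + 1 / q) \<partial>lborel) < \<infinity>"
proof -
  have "(\<integral>\<^sup>+q. ennreal (q powr (a - 1) * exp (- q)) * indicator {0<..} q * ennreal (1 + 1 / q) \<partial>lborel)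
    = (\<integral>\<^sup>+q. ennreal (q powr (a - 1) * exp (- (1 * q))) * indicator {0<..} q +
           ennreal (q powr ((a - 1) - 1) * exp (- (1 * q))) * indicator {0<..} q \<partial>lborel)"
  proof (rule nn_integral_cong)
    fix q :: real
    show "ennreal (q powr (a - 1) * exp (- q)) * indicator {0<..} q * ennreal (1 + 1 / q) =
      ennreal (q powr (a - 1) * exp (- (1 * q))) * indicator {0<..} q +
      ennreal (q powr ((a - 1) - 1) * exp (- (1 * q))) * indicator {0<..} q"
    proof (cases "q > 0")
      case True
      then have "q powr ((a - 1) - 1) = q powr (a - 1) / q"
        using powr_diff[of q "a - 1" 1] by (simp only: powr_one)
      then have "q powr (a - 1) * exp (- q) * (1 + 1 / q) = q powr (a - 1) * exp (- q) + q powr ((a - 1) - 1) * exp (- q)"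
        by (simp only: distrib_left) (simp only: mult_1_right times_divide_eq_right times_divide_eq_left)
      then show ?thesis using True
        by (simp add: ennreal_mult'[symmetric] ennreal_plus[symmetric] del: ennreal_plus)
    qed simp
  qed
  also have "\<dots> = ennreal (Gamma a * 1 powr (- a)) + ennreal (Gamma (a - 1) * 1 powr (- (a - 1)))"
  proof (subst nn_integral_add)
    show "(\<integral>\<^sup>+q. ennreal (q powr (a - 1) * exp (- (1 * q))) * indicator {0<..} q \<partial>lborel) +
      (\<integral>\<^sup>+q. ennreal (q powr ((a - 1) - 1) * exp (- (1 * q))) * indicator {0<..} q \<partial>lborel) =
      ennreal (Gamma a * 1 powr (- a)) + ennreal (Gamma (a - 1) * 1 powr (- (a - 1)))"
      using assms by (intro arg_cong2[where f="(+)"] nn_integral_Gamma_scaled) auto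
  qed measurable
  finally show ?thesis by simp
qed

text \<open>The bound is the one from \<open>phi_ratio_bound\<close>. It is shared by all rescaled
  potential densities and by their limit, the indicator of the half-line, and so serves as the
  common majorant.\<close>

definition laplace_bounded :: "(real \<Rightarrow> ennreal) \<Rightarrow> bool" where
  "laplace_bounded f \<longleftrightarrow> f \<in> borel_measurable borel \<and> (\<forall>t\<le>0. f t = 0) \<and>
     (\<forall>q>0. laplace f q \<le> ennreal (1 + 1 / q))"

lemma powr_weight_finite:
  assumes f: "laplace_bounded f" and a: "a > 1" and k: "k \<ge> 0"
  shows "(\<integral>\<^sup>+t. f t * ennreal ((1 + t) powr (- a) * exp (- (k * t))) \<partial>lborel) < \<infinity>"
proof -
  have [measurable]: "f \<in> borel_measurable borel" using f by (simp add: laplace_bounded_def)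
  have "laplace f (q + k) \<le> ennreal (1 + 1 / q)" if "q > 0" for q
  proof -
    from that have "laplace f (q + k) \<le> ennreal (1 + 1 / (q + k))" using f k that by (auto simp: laplace_bounded_def)
    also have "\<dots> \<le> ennreal (1 + 1 / q)" using k that by (intro ennreal_leI add_mono divide_left_mono) auto
    finally show ?thesis .
  qed
  then have le: "indicator {0<..} q * laplace f (q + k) \<le> indicator {0<..} q * ennreal (1 + 1 / q)" for q
    by (auto split: split_indicator)
  have "ennreal (Gamma a) * (\<integral>\<^sup>+t. f t * ennreal ((1 + t) powr (- a) * exp (- (k * t))) \<partial>lborel)
    \<le> (\<integral>\<^sup>+q. ennreal (q powr (a - 1) * exp (- q)) * indicator {0<..} q * ennreal (1 + 1 / q) \<partial>lborel)"
  proof (subst nn_integral_powr_weight)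
    show "(\<integral>\<^sup>+q. ennreal (q powr (a - 1) * exp (- q)) * indicator {0<..} q * laplace f (q + k) \<partial>lborel)
      \<le> (\<integral>\<^sup>+q. ennreal (q powr (a - 1) * exp (- q)) * indicator {0<..} q * ennreal (1 + 1 / q) \<partial>lborel)"
      unfolding mult.assoc by (intro nn_integral_mono mult_left_mono le) simp
  qed (use f a in \<open>auto simp: laplace_bounded_def\<close>)
  also have "\<dots> < \<infinity>" by (rule nn_integral_Gamma_bound_finite[OF a])
  finally have "ennreal (Gamma a) * (\<integral>\<^sup>+t. f t * ennreal ((1 + t) powr (- a) * exp (- (k * t))) \<partial>lborel) < \<infinity>" .
  moreover have "Gamma a > 0"
    using a by (intro Gamma_real_pos) auto
  ultimately show ?thesis
    by (auto simp: ennreal_mult_less_top)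
qed

text \<open>On the side of \<open>nn_integral_powr_weight\<close> this is dominated convergence in
  \<open>q\<close>; the shift by \<open>k \<ge> 0\<close> only makes the majorant
  \<open>1 + 1 / (q + k)\<close> smaller. The factor \<open>Gamma a > 0\<close> is cancelled at the
  end.\<close>

lemma powr_weight_tendsto:
  assumes f: "\<And>n. laplace_bounded (f n)" and g: "laplace_bounded g" and a: "a > 1" and k: "k \<ge> 0"
    and lim: "\<And>q. q > 0 \<Longrightarrow> (\<lambda>n. laplace (f n) q) \<longlonglongrightarrow> laplace g q"
  shows "(\<lambda>n. \<integral>\<^sup>+t. f n t * ennreal ((1 + t) powr (- a) * exp (- (k * t))) \<partial>lborel)
     \<longlonglongrightarrow> (\<integral>\<^sup>+t. g t * ennreal ((1 + t) powr (- a) * exp (- (k * t))) \<partial>lborel)"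
proof -
  let ?I = "\<lambda>f. \<integral>\<^sup>+t. f t * ennreal ((1 + t) powr (- a) * exp (- (k * t))) \<partial>lborel"
  let ?J = "\<lambda>f. \<integral>\<^sup>+q. ennreal (q powr (a - 1) * exp (- q)) * indicator {0<..} q * laplace f (q + k) \<partial>lborel"
  have [measurable]: "f n \<in> borel_measurable borel" "g \<in> borel_measurable borel" for n
    using f g by (auto simp: laplace_bounded_def)
  have le: "laplace (f n) (q + k) \<le> ennreal (1 + 1 / q)" if "q > 0" for q n
  proof -
    from that have "laplace (f n) (q + k) \<le> ennreal (1 + 1 / (q + k))" using f k that by (auto simp: laplace_bounded_def)
    also have "\<dots> \<le> ennreal (1 + 1 / q)" using k that by (intro ennreal_leI add_mono divide_left_mono) auto
    finally show ?thesis .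
  qed
  have le: "indicator {0<..} q * laplace (f n) (q + k) \<le> indicator {0<..} q * ennreal (1 + 1 / q)" for q n
    using le[of q n] by (cases "q > 0") (simp_all del: ennreal_plus)
  have "(\<lambda>n. ?J (f n)) \<longlonglongrightarrow> ?J g"
  proof (rule nn_integral_dominated_convergence)
    show "(\<integral>\<^sup>+q. ennreal (q powr (a - 1) * exp (- q)) * indicator {0<..} q * ennreal (1 + 1 / q) \<partial>lborel) < \<infinity>"
      by (rule nn_integral_Gamma_bound_finite[OF a])
    show "AE q in lborel. ennreal (q powr (a - 1) * exp (- q)) * indicator {0<..} q * laplace (f n) (q + k)
       \<le> ennreal (q powr (a - 1) * exp (- q)) * indicator {0<..} q * ennreal (1 + 1 / q)" for n
      unfolding mult.assoc by (intro always_eventually allI mult_left_mono le) simp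
    show "AE q in lborel. (\<lambda>n. ennreal (q powr (a - 1) * exp (- q)) * indicator {0<..} q * laplace (f n) (q + k))
       \<longlonglongrightarrow> ennreal (q powr (a - 1) * exp (- q)) * indicator {0<..} q * laplace g (q + k)"
    proof (intro always_eventually allI)
      fix q :: real
      show "(\<lambda>n. ennreal (q powr (a - 1) * exp (- q)) * indicator {0<..} q * laplace (f n) (q + k))
       \<longlonglongrightarrow> ennreal (q powr (a - 1) * exp (- q)) * indicator {0<..} q * laplace g (q + k)"
      proof (cases "q > 0")
        case True
        then show ?thesis using k lim[of "q + k"] by (intro tendsto_mult_ennreal tendsto_const) auto
      qed auto
    qed
  qed measurable
  moreover have "?J h = ennreal (Gamma a) * ?I h" if "laplace_bounded h" for h
    using that a by (intro nn_integral_powr_weight[symmetric]) (auto simp: laplace_bounded_def)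
  ultimately have "(\<lambda>n. ennreal (Gamma a) * ?I (f n)) \<longlonglongrightarrow> ennreal (Gamma a) * ?I g"
    using f g by simp
  moreover have Gpos: "Gamma a > 0"
    using a by (intro Gamma_real_pos) auto
  ultimately have "(\<lambda>n. ennreal (1 / Gamma a) * (ennreal (Gamma a) * ?I (f n))) \<longlonglongrightarrow> ennreal (1 / Gamma a) * (ennreal (Gamma a) * ?I g)"
    by - (rule tendsto_mult_ennreal[OF tendsto_const], auto)
  then show ?thesis
    using Gpos by (simp add: mult.assoc[symmetric] ennreal_mult'[symmetric])
qed

text \<open>
  Karamata's Tauberian theorem. The weight \<open>(1 + t) powr (- a)\<close> is a mixture of exponentials, so
  convergence of Laplace transforms gives convergence of the weighted integrals of \<open>exp (- k t)\<close>;
  Weierstrass approximation in the variable \<open>exp (- t) \<in> [0, 1]\<close>, whose end point \<open>0\<close> stands for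
  \<open>t = \<infinity>\<close>, gives the general case.
\<close>

lemma karamata:
  assumes f: "\<And>n. laplace_bounded (f n)" and g: "laplace_bounded g" and a: "a > 1"
    and lim: "\<And>q. q > 0 \<Longrightarrow> (\<lambda>n. laplace (f n) q) \<longlonglongrightarrow> laplace g q"
    and v: "continuous_on {0..1} v" and [measurable]: "v \<in> borel_measurable borel"
  shows "(\<lambda>n. \<integral>t. (1 + t) powr (- a) * v (exp (- t)) \<partial>density lborel (f n))
     \<longlonglongrightarrow> (\<integral>t. (1 + t) powr (- a) * v (exp (- t)) \<partial>density lborel g)"
proof -
  define I where "I h v = (\<integral>t. (1 + t) powr (- a) * v (exp (- t)) \<partial>density lborel h)" for h v
  have bd: "h \<in> borel_measurable borel" if "laplace_bounded h" for h
    using that by (auto simp: laplace_bounded_def)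
  note fm [measurable] = bd[OF f] bd[OF g]
  have ind: "((1 + t) powr (- a) * exp (- t) ^ k) = (1 + t) powr (- a) * exp (- (real k * t))" for t and k :: nat
    by (simp add: exp_of_nat_mult[symmetric])
  have int_pow: "integrable (density lborel h) (\<lambda>t. (1 + t) powr (- a) * exp (- t) ^ k)"
    and I_pow: "I h (\<lambda>z. z ^ k) = enn2real (\<integral>\<^sup>+t. h t * ennreal ((1 + t) powr (- a) * exp (- (real k * t))) \<partial>lborel)"
    if h: "laplace_bounded h" for h and k :: nat
  proof -
    note [measurable] = bd[OF h]
    have eq: "(\<integral>\<^sup>+t. ennreal ((1 + t) powr (- a) * exp (- (real k * t))) \<partial>density lborel h)
       = (\<integral>\<^sup>+t. h t * ennreal ((1 + t) powr (- a) * exp (- (real k * t))) \<partial>lborel)"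
      by (rule nn_integral_density) measurable
    show "integrable (density lborel h) (\<lambda>t. (1 + t) powr (- a) * exp (- t) ^ k)"
      unfolding ind by (rule integrableI_nonneg) (use powr_weight_finite[OF h a, of "real k"] eq in auto)
    show "I h (\<lambda>z. z ^ k) = enn2real (\<integral>\<^sup>+t. h t * ennreal ((1 + t) powr (- a) * exp (- (real k * t))) \<partial>lborel)"
      unfolding I_def ind eq[symmetric] by (rule integral_eq_nn_integral) auto
  qed
  have lim_pow: "(\<lambda>n. I (f n) (\<lambda>z. z ^ k)) \<longlonglongrightarrow> I g (\<lambda>z. z ^ k)" for k
    unfolding I_pow[OF f] I_pow[OF g]
  proof (rule tendsto_enn2real)
    show "(\<lambda>n. \<integral>\<^sup>+t. f n t * ennreal ((1 + t) powr (- a) * exp (- (real k * t))) \<partial>lborel) \<longlonglongrightarrow>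
      ennreal (enn2real (\<integral>\<^sup>+t. g t * ennreal ((1 + t) powr (- a) * exp (- (real k * t))) \<partial>lborel))"
      using powr_weight_tendsto[OF f g a, of "real k"] lim powr_weight_finite[OF g a, of "real k"] by simp
  qed simp
  have pos_AE: "AE t in density lborel h. t > 0" if h: "laplace_bounded h" for h
  proof -
    have "t > 0" if "h t > 0" for t
      using h that by (cases "t > 0") (auto simp: laplace_bounded_def)
    then show ?thesis
      using bd[OF h] by (subst AE_density) (auto intro!: AE_I2)
  qed
  \<comment> \<open>Mass of the weighted measure. As it converges, it is eventually below
    \<open>W g + 1\<close>, so one uniform polynomial approximation works for almost all
    \<open>n\<close>.\<close>
  define W where "W h = I h (\<lambda>z. z ^ 0)" for h
  have W_nonneg: "W h \<ge> 0" for h unfolding W_def I_def by (intro Bochner_Integration.integral_nonneg) auto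
  have W_lim: "(\<lambda>n. W (f n)) \<longlonglongrightarrow> W g" unfolding W_def by (rule lim_pow)
  obtain B where B: "\<And>z. z \<in> {0..1} \<Longrightarrow> \<bar>v z\<bar> \<le> B"
  proof -
    obtain B where "\<forall>x\<in>v ` {0..1}. norm x \<le> B"
      using compact_imp_bounded[OF compact_continuous_image[OF v compact_Icc]] unfolding bounded_iff by blast
    then show ?thesis by (intro that[of B]) simp
  qed
  have int_v: "integrable (density lborel h) (\<lambda>t. (1 + t) powr (- a) * v (exp (- t)))"
    if h: "laplace_bounded h" for h
  proof (rule Bochner_Integration.integrable_bound)
    show "integrable (density lborel h) (\<lambda>t. B * ((1 + t) powr (- a) * exp (- t) ^ 0))"
      by (intro integrable_mult_right int_pow h)
    show "AE t in density lborel h. norm ((1 + t) powr (- a) * v (exp (- t))) \<le> norm (B * ((1 + t) powr (- a) * exp (- t) ^ 0))"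
    proof -
      have "norm ((1 + t) powr (- a) * v (exp (- t))) \<le> norm (B * ((1 + t) powr (- a) * exp (- t) ^ 0))" if "t > 0" for t
      proof -
        have "\<bar>v (exp (- t))\<bar> \<le> \<bar>B\<bar>" using that B[of "exp (- t)"] by simp
        then show ?thesis by (simp add: abs_mult mult.commute mult_right_mono)
      qed
      from pos_AE[OF h] show ?thesis by eventually_elim fact
    qed
  qed measurable
  have diff: "\<bar>I h v - I h P\<bar> \<le> e * W h"
    if h: "laplace_bounded h" and P: "integrable (density lborel h) (\<lambda>t. (1 + t) powr (- a) * P (exp (- t)))"
      and e: "\<And>z. z \<in> {0..1} \<Longrightarrow> \<bar>v z - P z\<bar> \<le> e" for h P e
  proof -
    have "\<bar>I h v - I h P\<bar> = \<bar>\<integral>t. (1 + t) powr (- a) * v (exp (- t)) - (1 + t) powr (- a) * P (exp (- t)) \<partial>density lborel h\<bar>"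
      unfolding I_def using int_v[OF h] P by simp
    also have "\<dots> \<le> (\<integral>t. \<bar>(1 + t) powr (- a) * v (exp (- t)) - (1 + t) powr (- a) * P (exp (- t))\<bar> \<partial>density lborel h)"
      by (rule integral_abs_bound)
    also have "\<dots> \<le> (\<integral>t. e * ((1 + t) powr (- a) * exp (- t) ^ 0) \<partial>density lborel h)"
    proof (rule integral_mono_AE)
      show "AE t in density lborel h. \<bar>(1 + t) powr (- a) * v (exp (- t)) - (1 + t) powr (- a) * P (exp (- t))\<bar>
          \<le> e * ((1 + t) powr (- a) * exp (- t) ^ 0)"
      proof -
        have "\<bar>(1 + t) powr (- a) * v (exp (- t)) - (1 + t) powr (- a) * P (exp (- t))\<bar>
            \<le> e * ((1 + t) powr (- a) * exp (- t) ^ 0)" if "t > 0" for t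
        proof -
          have "(1 + t) powr (- a) * \<bar>v (exp (- t)) - P (exp (- t))\<bar> \<le> (1 + t) powr (- a) * e"
            using that by (intro mult_left_mono e) auto
          then show ?thesis unfolding right_diff_distrib[symmetric] abs_mult by (simp add: mult.commute)
        qed
        from pos_AE[OF h] show ?thesis by eventually_elim fact
      qed
      show "integrable (density lborel h) (\<lambda>t. \<bar>(1 + t) powr (- a) * v (exp (- t)) - (1 + t) powr (- a) * P (exp (- t))\<bar>)"
        by (intro integrable_abs Bochner_Integration.integrable_diff int_v h P)
      show "integrable (density lborel h) (\<lambda>t. e * ((1 + t) powr (- a) * exp (- t) ^ 0))"
        by (intro integrable_mult_right int_pow h)
    qed
    also have "\<dots> = e * W h"
      unfolding W_def I_def by (subst integral_mult_right_zero) (rule refl)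
    finally show ?thesis .
  qed
  have "(\<lambda>n. I (f n) v) \<longlonglongrightarrow> I g v"
  proof (rule tendstoI)
    fix r :: real assume r: "r > 0"
    have d: "2 * W g + 3 > 0" using W_nonneg[of g] by linarith
    \<comment> \<open>The error budget is \<open>e * (W g + 1)\<close> for replacing
      \<open>v\<close> by \<open>P\<close> under \<open>f n\<close>, \<open>e * W g\<close> for the
      same under \<open>g\<close>, and \<open>e\<close> for the convergence with \<open>P\<close>;
      the total is at most \<open>e * (2 * W g + 3)\<close>.\<close>
    define e where "e = r / (2 * W g + 3)"
    have e: "e > 0" unfolding e_def using r d by (rule divide_pos_pos)
    obtain P where "real_polynomial_function P" and P: "\<And>z. z \<in> {0..1} \<Longrightarrow> \<bar>v z - P z\<bar> < e"
      using Stone_Weierstrass_real_polynomial_function[OF compact_Icc v e] by metis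
    then obtain c N where Pc: "P = (\<lambda>z. \<Sum>i\<le>N. c i * z ^ i)"
      by (auto simp: real_polynomial_function_iff_sum)
    have P_eq: "(1 + t) powr (- a) * P (exp (- t)) = (\<Sum>i\<le>N. c i * ((1 + t) powr (- a) * exp (- t) ^ i))" for t
      by (simp add: Pc sum_distrib_left mult_ac)
    have int_P: "integrable (density lborel h) (\<lambda>t. (1 + t) powr (- a) * P (exp (- t)))" if h: "laplace_bounded h" for h
      unfolding P_eq by (intro Bochner_Integration.integrable_sum integrable_mult_right int_pow h)
    have I_P: "I h P = (\<Sum>i\<le>N. c i * I h (\<lambda>z. z ^ i))" if h: "laplace_bounded h" for h
      unfolding I_def P_eq using int_pow[OF h] by (subst Bochner_Integration.integral_sum) auto
    have "(\<lambda>n. I (f n) P) \<longlonglongrightarrow> I g P"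
      unfolding I_P[OF f] I_P[OF g] by (intro tendsto_intros lim_pow)
    then have "eventually (\<lambda>n. dist (I (f n) P) (I g P) < e) sequentially"
      using e by (rule tendstoD)
    moreover have "eventually (\<lambda>n. W (f n) < W g + 1) sequentially"
      by (rule order_tendstoD[OF W_lim]) simp
    ultimately show "eventually (\<lambda>n. dist (I (f n) v) (I g v) < r) sequentially"
    proof eventually_elim
      case (elim n)
      have "\<bar>I (f n) v - I (f n) P\<bar> \<le> e * W (f n)"
        by (intro diff f int_P less_imp_le[OF P])
      also have "\<dots> \<le> e * (W g + 1)" using elim e by simp
      finally have 1: "\<bar>I (f n) v - I (f n) P\<bar> \<le> e * (W g + 1)" .
      have 2: "\<bar>I g v - I g P\<bar> \<le> e * W g"
        by (intro diff g int_P less_imp_le[OF P])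
      have "\<bar>I (f n) v - I g v\<bar> < e * (W g + 1) + e + e * W g"
        using 1 2 elim(1) unfolding dist_real_def by linarith
      also have "\<dots> \<le> e * (2 * W g + 3)" using e by (simp add: algebra_simps)
      also have "\<dots> = r" unfolding e_def using d by simp
      finally show ?case by (simp add: dist_real_def)
    qed
  qed
  then show ?thesis by (simp add: I_def)
qed

section \<open>Gaussian integrals and mixtures of exponentials\<close>

lemma
  fixes f :: "'a::euclidean_space \<Rightarrow> real \<Rightarrow> 'b::{real_normed_field,banach,second_countable_topology}"
  assumes f: "\<And>b. b \<in> Basis \<Longrightarrow> integrable lborel (f b)"
  shows integrable_prod_Basis: "integrable lborel (\<lambda>x. \<Prod>b\<in>Basis. f b (x \<bullet> b))"
    and integral_prod_Basis: "(\<integral>x. (\<Prod>b\<in>Basis. f b (x \<bullet> b)) \<partial>lborel) = (\<Prod>b\<in>Basis. \<integral>t. f b t \<partial>lborel)"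
proof -
  interpret product_sigma_finite "\<lambda>_::'a. lborel :: real measure" ..
  have [measurable]: "f b \<in> borel_measurable borel" if "b \<in> Basis" for b
    using f[OF that] by (simp add: borel_measurable_integrable[unfolded measurable_lborel1])
  have meas: "(\<lambda>x::'a. \<Prod>b\<in>Basis. f b (x \<bullet> b)) \<in> borel_measurable borel"
    by (intro borel_measurable_prod) measurable
  have m2: "(\<lambda>g. \<Sum>b\<in>Basis. g b *\<^sub>R b) \<in> measurable (\<Pi>\<^sub>M b\<in>(Basis::'a set). lborel) borel"
    by measurable
  have eq: "(\<Prod>b\<in>Basis. f b ((\<Sum>c\<in>Basis. g c *\<^sub>R c) \<bullet> b)) = (\<Prod>b\<in>Basis. f b (g b))" for g :: "'a \<Rightarrow> real"
    by (intro prod.cong) auto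
  show "integrable lborel (\<lambda>x. \<Prod>b\<in>Basis. f b (x \<bullet> b))"
    using f unfolding lborel_eq[where 'a='a]
    by (subst integrable_distr_eq[OF m2 meas]) (auto simp: eq intro!: product_integrable_prod)
  show "(\<integral>x. (\<Prod>b\<in>Basis. f b (x \<bullet> b)) \<partial>lborel) = (\<Prod>b\<in>Basis. \<integral>t. f b t \<partial>lborel)"
    using f unfolding lborel_eq[where 'a='a]
    by (subst integral_distr[OF m2 meas]) (auto simp: eq intro!: product_integral_prod)
qed

text \<open>The substitution \<open>x = c * x'\<close> with \<open>c = sqrt (2 * s)\<close> reduces
  this to the characteristic function of the standard normal law.\<close>

lemma
  assumes s: "s > (0::real)"
  shows integrable_gauss_iexp: "integrable lborel (\<lambda>x. complex_of_real (exp (- (s * x\<^sup>2))) * iexp (x * y))"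
    and integral_gauss_iexp: "(\<integral>x. complex_of_real (exp (- (s * x\<^sup>2))) * iexp (x * y) \<partial>lborel)
      = complex_of_real (sqrt (pi / s) * exp (- (y\<^sup>2 / (4 * s))))"
proof -
  define c where "c = sqrt (2 * s)"
  have c: "c > 0" "c\<^sup>2 = 2 * s" using s by (auto simp: c_def)
  define f where "f x = complex_of_real (std_normal_density x) * iexp (y / c * x)" for x
  have fint: "integrable lborel f"
  proof (rule Bochner_Integration.integrable_bound)
    show "integrable lborel std_normal_density" by (intro integrable_normal_density) simp
    show "AE x in lborel. norm (f x) \<le> norm (std_normal_density x)"
      by (auto simp: f_def norm_mult)
  qed (simp add: f_def[abs_def])
  have "complex_of_real (exp (- (y / c)\<^sup>2 / 2)) = char std_normal_distribution (y / c)"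
    by (simp add: char_std_normal_distribution)
  also have "\<dots> = (\<integral>x. f x \<partial>lborel)"
    unfolding char_def f_def by (subst integral_density) (auto simp: normal_density_nonneg scaleR_conv_of_real)
  also have "\<dots> = \<bar>c\<bar> *\<^sub>R (\<integral>x. f (0 + c * x) \<partial>lborel)"
    using c by (intro lborel_integral_real_affine) auto
  finally have eq0: "complex_of_real (exp (- (y / c)\<^sup>2 / 2)) = \<bar>c\<bar> *\<^sub>R (\<integral>x. f (0 + c * x) \<partial>lborel)" .
  have feq: "f (0 + c * x) = complex_of_real (1 / sqrt (2 * pi)) * (complex_of_real (exp (- (s * x\<^sup>2))) * iexp (x * y))" for x
    using c by (simp add: f_def normal_density_def power_mult_distrib mult_ac)
  have eq: "complex_of_real (exp (- (y / c)\<^sup>2 / 2)) =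
     c *\<^sub>R (\<integral>x. complex_of_real (1 / sqrt (2 * pi)) * (complex_of_real (exp (- (s * x\<^sup>2))) * iexp (x * y)) \<partial>lborel)"
    using c eq0 unfolding feq by simp
  have "integrable lborel (\<lambda>x. f (0 + c * x))"
    using c by (intro lborel_integrable_real_affine fint) auto
  then have "integrable lborel (\<lambda>x. complex_of_real (sqrt (2 * pi)) * f (0 + c * x))"
    by (rule integrable_mult_right)
  moreover have "complex_of_real (sqrt (2 * pi)) * f (0 + c * x) = complex_of_real (exp (- (s * x\<^sup>2))) * iexp (x * y)" for x
    unfolding feq by simp
  ultimately show int: "integrable lborel (\<lambda>x. complex_of_real (exp (- (s * x\<^sup>2))) * iexp (x * y))"
    by simp
  have "complex_of_real (exp (- (y / c)\<^sup>2 / 2)) =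
     complex_of_real (c / sqrt (2 * pi)) * (\<integral>x. complex_of_real (exp (- (s * x\<^sup>2))) * iexp (x * y) \<partial>lborel)"
    unfolding eq by (subst integral_mult_right_zero) (simp add: scaleR_conv_of_real)
  then have "(\<integral>x. complex_of_real (exp (- (s * x\<^sup>2))) * iexp (x * y) \<partial>lborel) =
     complex_of_real (sqrt (2 * pi) / c) * complex_of_real (exp (- (y / c)\<^sup>2 / 2))"
    using c by (simp add: field_simps)
  also have "sqrt (2 * pi) / c = sqrt (pi / s)"
    using s by (simp add: c_def real_sqrt_divide[symmetric])
  also have "- (y / c)\<^sup>2 / 2 = - (y\<^sup>2 / (4 * s))"
    using c s by (simp add: power_divide)
  finally show "(\<integral>x. complex_of_real (exp (- (s * x\<^sup>2))) * iexp (x * y) \<partial>lborel)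
      = complex_of_real (sqrt (pi / s) * exp (- (y\<^sup>2 / (4 * s))))" by simp
qed

lemma norm_sq_Basis: "(norm (x::'a::euclidean_space))\<^sup>2 = (\<Sum>b\<in>Basis. (x \<bullet> b)\<^sup>2)"
  by (subst power2_norm_eq_inner, subst euclidean_inner) (simp only: power2_eq_square)

lemma
  fixes z :: "'a::euclidean_space"
  assumes s: "s > 0"
  shows integrable_gauss_cos: "integrable lborel (\<lambda>\<xi>. exp (- (s * (norm \<xi>)\<^sup>2)) * cos (\<xi> \<bullet> z))"
    and integral_gauss_cos: "(\<integral>\<xi>. exp (- (s * (norm \<xi>)\<^sup>2)) * cos (\<xi> \<bullet> z) \<partial>lborel) =
       (pi / s) powr (real DIM('a) / 2) * exp (- ((norm z)\<^sup>2 / (4 * s)))"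
proof -
  define f where "f b x = complex_of_real (exp (- (s * x\<^sup>2))) * iexp (x * (z \<bullet> b))" for b x
  have feq: "(\<Prod>b\<in>Basis. f b (\<xi> \<bullet> b)) = complex_of_real (exp (- (s * (norm \<xi>)\<^sup>2))) * iexp (\<xi> \<bullet> z)" for \<xi>
  proof -
    have "(\<Prod>b\<in>Basis. f b (\<xi> \<bullet> b)) = complex_of_real (\<Prod>b\<in>Basis. exp (- (s * (\<xi> \<bullet> b)\<^sup>2))) *
        (\<Prod>b\<in>Basis. iexp ((\<xi> \<bullet> b) * (z \<bullet> b)))"
      by (simp add: f_def prod.distrib)
    also have "(\<Prod>b\<in>Basis. exp (- (s * (\<xi> \<bullet> b)\<^sup>2))) = exp (- (s * (norm \<xi>)\<^sup>2))"
      by (simp add: exp_sum[symmetric] norm_sq_Basis sum_distrib_left sum_negf)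
    also have "(\<Prod>b\<in>Basis. iexp ((\<xi> \<bullet> b) * (z \<bullet> b))) = iexp (\<xi> \<bullet> z)"
      by (subst euclidean_inner) (simp add: exp_sum[symmetric] sum_distrib_left)
    finally show ?thesis .
  qed
  have re: "Re (complex_of_real (exp (- (s * (norm \<xi>)\<^sup>2))) * iexp (\<xi> \<bullet> z)) = exp (- (s * (norm \<xi>)\<^sup>2)) * cos (\<xi> \<bullet> z)" for \<xi>
    by (simp add: Re_exp)
  have f: "integrable lborel (f b)" for b unfolding f_def by (rule integrable_gauss_iexp[OF s])
  have int: "integrable lborel (\<lambda>\<xi>. complex_of_real (exp (- (s * (norm \<xi>)\<^sup>2))) * iexp (\<xi> \<bullet> z))"
    using integrable_prod_Basis[of f] f unfolding feq by blast
  show "integrable lborel (\<lambda>\<xi>. exp (- (s * (norm \<xi>)\<^sup>2)) * cos (\<xi> \<bullet> z))"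
    using integrable_Re[OF int] unfolding re .
  have "(\<integral>\<xi>. exp (- (s * (norm \<xi>)\<^sup>2)) * cos (\<xi> \<bullet> z) \<partial>lborel) =
     Re (\<integral>\<xi>. complex_of_real (exp (- (s * (norm \<xi>)\<^sup>2))) * iexp (\<xi> \<bullet> z) \<partial>lborel)"
    using integral_Re[OF int] unfolding re .
  also have "(\<integral>\<xi>. complex_of_real (exp (- (s * (norm \<xi>)\<^sup>2))) * iexp (\<xi> \<bullet> z) \<partial>lborel) = (\<Prod>b\<in>Basis. \<integral>t. f b t \<partial>lborel)"
    using integral_prod_Basis[of f] f unfolding feq by blast
  also have "\<dots> = (\<Prod>b\<in>(Basis::'a set). complex_of_real (sqrt (pi / s) * exp (- ((z \<bullet> b)\<^sup>2 / (4 * s)))))"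
    unfolding f_def by (simp only: integral_gauss_iexp[OF s])
  also have "\<dots> = complex_of_real (sqrt (pi / s) ^ DIM('a) * exp (- ((norm z)\<^sup>2 / (4 * s))))"
    by (simp add: prod.distrib exp_sum[symmetric] norm_sq_Basis sum_divide_distrib sum_negf of_real_prod[symmetric]
             del: of_real_prod)
  also have "sqrt (pi / s) ^ DIM('a) = (pi / s) powr (real DIM('a) / 2)"
    using s by (simp add: powr_half_sqrt[symmetric] powr_powr powr_realpow[symmetric] del: powr_realpow)
  finally show "(\<integral>\<xi>. exp (- (s * (norm \<xi>)\<^sup>2)) * cos (\<xi> \<bullet> z) \<partial>lborel) =
       (pi / s) powr (real DIM('a) / 2) * exp (- ((norm z)\<^sup>2 / (4 * s)))" by simp
qed

lemma integrable_gauss: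
  "s > 0 \<Longrightarrow> integrable lborel (\<lambda>\<xi>::'a::euclidean_space. exp (- (s * (norm \<xi>)\<^sup>2)))"
  using integrable_gauss_cos[of s "0::'a"] by simp

lemma integrable_exp_norm:
  assumes t: "t > 0"
  shows "integrable lborel (\<lambda>\<xi>::'a::euclidean_space. exp (- (t * norm \<xi>)))"
proof -
  \<comment> \<open>Each coordinate is at most \<open>norm \<xi>\<close> in absolute value, so
    dividing \<open>t\<close> by the dimension makes the product of one-dimensional exponentials a
    majorant.\<close>
  define a where "a = t / real DIM('a)"
  have a: "a > 0" using t by (simp add: a_def)
  have i1: "integrable lborel (\<lambda>x. indicator {0<..} x * exp (- (a * x)))"
    using nn_integral_exp_pos[OF a]
    by (intro integrableI_nonneg) (auto simp: ennreal_mult' ennreal_indicator)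
  then have i2: "integrable lborel (\<lambda>x. indicator {0<..} (- x) * exp (- (a * (- x))))"
    using lborel_integrable_real_affine[OF i1, of "-1" 0] by simp
  have "integrable lborel (\<lambda>x. exp (- (a * \<bar>x\<bar>)))"
  proof (rule Bochner_Integration.integrable_bound[OF Bochner_Integration.integrable_add[OF i1 i2]])
    show "AE x in lborel. norm (exp (- (a * \<bar>x\<bar>))) \<le>
       norm (indicator {0<..} x * exp (- (a * x)) + indicator {0<..} (- x) * exp (- (a * (- x))))"
      using AE_lborel_singleton[of "0::real"]
    proof eventually_elim
      case (elim x)
      then show ?case by (cases "x > 0") (auto split: split_indicator)
    qed
  qed auto
  then have "integrable lborel (\<lambda>\<xi>::'a. \<Prod>b\<in>Basis. exp (- (a * \<bar>\<xi> \<bullet> b\<bar>)))"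
    by (rule integrable_prod_Basis)
  then show ?thesis
  proof (rule Bochner_Integration.integrable_bound)
    show "AE \<xi>::'a in lborel. norm (exp (- (t * norm \<xi>))) \<le> norm (\<Prod>b\<in>Basis. exp (- (a * \<bar>\<xi> \<bullet> b\<bar>)))"
    proof (intro AE_I2)
      fix \<xi> :: 'a
      have "(\<Sum>b\<in>Basis. \<bar>\<xi> \<bullet> b\<bar>) \<le> (\<Sum>b\<in>(Basis::'a set). norm \<xi>)"
        by (intro sum_mono) (rule Basis_le_norm)
      then have "a * (\<Sum>b\<in>Basis. \<bar>\<xi> \<bullet> b\<bar>) \<le> a * (real DIM('a) * norm \<xi>)"
        using a by (intro mult_left_mono) auto
      also have "\<dots> = t * norm \<xi>" by (simp add: a_def)
      finally show "norm (exp (- (t * norm \<xi>))) \<le> norm (\<Prod>b\<in>Basis. exp (- (a * \<bar>\<xi> \<bullet> b\<bar>)))"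
        by (simp add: exp_sum[symmetric] sum_negf sum_distrib_left)
    qed
  qed auto
qed

section \<open>Fubini for mixtures of exponentials\<close>

lemma (in pair_sigma_finite) integrable_pair_bounded:
  fixes f :: "'a \<times> 'b \<Rightarrow> real"
  assumes [measurable]: "f \<in> borel_measurable (M1 \<Otimes>\<^sub>M M2)" "g \<in> borel_measurable (M1 \<Otimes>\<^sub>M M2)"
    and le: "\<And>x y. \<bar>f (x, y)\<bar> \<le> g (x, y)"
    and fin: "(\<integral>\<^sup>+x. \<integral>\<^sup>+y. ennreal (g (x, y)) \<partial>M2 \<partial>M1) < \<infinity>"
  shows "integrable (M1 \<Otimes>\<^sub>M M2) f"
proof (rule integrableI_bounded)
  have "(\<integral>\<^sup>+z. ennreal (norm (f z)) \<partial>(M1 \<Otimes>\<^sub>M M2)) \<le> (\<integral>\<^sup>+z. ennreal (g z) \<partial>(M1 \<Otimes>\<^sub>M M2))"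
    using le by (intro nn_integral_mono) (auto intro!: ennreal_leI)
  also have "\<dots> = (\<integral>\<^sup>+x. \<integral>\<^sup>+y. ennreal (g (x, y)) \<partial>M2 \<partial>M1)"
    by (rule M2.nn_integral_fst[symmetric]) measurable
  finally show "(\<integral>\<^sup>+z. ennreal (norm (f z)) \<partial>(M1 \<Otimes>\<^sub>M M2)) < \<infinity>"
    using fin by (simp add: order.strict_trans1)
qed measurable

text \<open>The right-hand side sees \<open>v\<close> and \<open>c\<close> only through
  \<open>P\<close>. Two pairs with the same \<open>P\<close> therefore give equal integrals, which
  is how a potential integral (\<open>c \<xi> = |\<xi>|\<^sup>2\<close>) is compared with a time
  integral (\<open>c = log_exponent\<close>). Bounding the cosine by 1 gives absolute integrability.
  The origin, where the transform may be infinite, is a null set.\<close>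

lemma
  fixes w c P :: "'a::euclidean_space \<Rightarrow> real" and v :: "real \<Rightarrow> real"
  assumes [measurable]: "w \<in> borel_measurable borel" "c \<in> borel_measurable borel"
      "P \<in> borel_measurable borel" "v \<in> borel_measurable borel"
    and w: "\<And>\<xi>. w \<xi> \<ge> 0" and v: "\<And>\<theta>. v \<theta> \<ge> 0" and P: "\<And>\<xi>. P \<xi> \<ge> 0"
    and L: "\<And>\<xi>. \<xi> \<noteq> 0 \<Longrightarrow> laplace (\<lambda>\<theta>. ennreal (v \<theta>)) (c \<xi>) = ennreal (P \<xi>)"
    and int: "integrable lborel (\<lambda>\<xi>. w \<xi> * P \<xi>)"
  shows integrable_laplace_mixture:
      "integrable lborel (\<lambda>\<theta>. v \<theta> * (\<integral>\<xi>. w \<xi> * exp (- (c \<xi> * \<theta>)) * cos (\<xi> \<bullet> y) \<partial>lborel))"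
    and integral_laplace_mixture:
      "(\<integral>\<theta>. v \<theta> * (\<integral>\<xi>. w \<xi> * exp (- (c \<xi> * \<theta>)) * cos (\<xi> \<bullet> y) \<partial>lborel) \<partial>lborel) =
       (\<integral>\<xi>. w \<xi> * P \<xi> * cos (\<xi> \<bullet> y) \<partial>lborel)"
proof -
  define f where "f = (\<lambda>(\<xi>, \<theta>). w \<xi> * cos (\<xi> \<bullet> y) * (v \<theta> * exp (- (c \<xi> * \<theta>))))"
  define g where "g = (\<lambda>(\<xi>, \<theta>). w \<xi> * (v \<theta> * exp (- (c \<xi> * \<theta>))))"
  have [measurable]: "f \<in> borel_measurable (borel \<Otimes>\<^sub>M borel)" "g \<in> borel_measurable (borel \<Otimes>\<^sub>M borel)"
    unfolding f_def g_def by measurable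
  have AE0: "AE \<xi>::'a in lborel. \<xi> \<noteq> 0" by (rule AE_lborel_singleton)
  have "(\<integral>\<^sup>+\<xi>. \<integral>\<^sup>+\<theta>. ennreal (g (\<xi>, \<theta>)) \<partial>lborel \<partial>lborel) = (\<integral>\<^sup>+\<xi>. ennreal (w \<xi> * P \<xi>) \<partial>lborel)"
  proof (rule nn_integral_cong_AE, use AE0 in eventually_elim)
    case (elim \<xi>)
    have "(\<integral>\<^sup>+\<theta>. ennreal (g (\<xi>, \<theta>)) \<partial>lborel) = ennreal (w \<xi>) * laplace (\<lambda>\<theta>. ennreal (v \<theta>)) (c \<xi>)"
      unfolding laplace_def g_def using w v by (subst nn_integral_cmult[symmetric]) (auto simp: ennreal_mult)
    then show ?case using L[OF elim] w P by (simp add: ennreal_mult)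
  qed
  also have "\<dots> < \<infinity>"
    using int w P by (simp add: integrable_iff_bounded)
  finally have f_int: "integrable (lborel \<Otimes>\<^sub>M lborel) f"
    by (intro lborel_pair.integrable_pair_bounded[where g=g])
       (auto simp: f_def g_def abs_mult w v mult_left_le intro!: mult_right_mono mult_left_le)
  have f_int': "integrable (lborel \<Otimes>\<^sub>M lborel) (\<lambda>(\<xi>, \<theta>). f (\<xi>, \<theta>))" using f_int by simp
  have inner: "(\<integral>\<xi>. f (\<xi>, \<theta>) \<partial>lborel) = v \<theta> * (\<integral>\<xi>. w \<xi> * exp (- (c \<xi> * \<theta>)) * cos (\<xi> \<bullet> y) \<partial>lborel)" for \<theta>
    unfolding f_def by (subst integral_mult_right_zero[symmetric]) (auto intro!: Bochner_Integration.integral_cong simp: mult_ac)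
  show "integrable lborel (\<lambda>\<theta>. v \<theta> * (\<integral>\<xi>. w \<xi> * exp (- (c \<xi> * \<theta>)) * cos (\<xi> \<bullet> y) \<partial>lborel))"
    using lborel_pair.integrable_snd[OF f_int'] unfolding inner .
  have "(\<integral>\<theta>. v \<theta> * (\<integral>\<xi>. w \<xi> * exp (- (c \<xi> * \<theta>)) * cos (\<xi> \<bullet> y) \<partial>lborel) \<partial>lborel) = (\<integral>\<xi>. \<integral>\<theta>. f (\<xi>, \<theta>) \<partial>lborel \<partial>lborel)"
    using lborel_pair.Fubini_integral[OF f_int'] unfolding inner .
  also have "\<dots> = (\<integral>\<xi>. w \<xi> * P \<xi> * cos (\<xi> \<bullet> y) \<partial>lborel)"
  proof (rule integral_cong_AE, measurable, use AE0 in eventually_elim)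
    case (elim \<xi>)
    have "(\<integral>\<theta>. v \<theta> * exp (- (c \<xi> * \<theta>)) \<partial>lborel) = enn2real (laplace (\<lambda>\<theta>. ennreal (v \<theta>)) (c \<xi>))"
      unfolding laplace_def using v by (subst integral_eq_nn_integral) (auto simp: ennreal_mult)
    then have "(\<integral>\<theta>. v \<theta> * exp (- (c \<xi> * \<theta>)) \<partial>lborel) = P \<xi>"
      using L[OF elim] P by simp
    then show ?case by (simp add: f_def)
  qed
  finally show "(\<integral>\<theta>. v \<theta> * (\<integral>\<xi>. w \<xi> * exp (- (c \<xi> * \<theta>)) * cos (\<xi> \<bullet> y) \<partial>lborel) \<partial>lborel) =
       (\<integral>\<xi>. w \<xi> * P \<xi> * cos (\<xi> \<bullet> y) \<partial>lborel)" .
qed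

section \<open>Fourier representation of the Green function\<close>

definition potential_density :: "real \<Rightarrow> real" where
  "potential_density t = enn2real (renewal_density t)"

lemma potential_density_nonneg: "potential_density t \<ge> 0" and potential_density_nonpos: "t \<le> 0 \<Longrightarrow> potential_density t = 0"
  by (auto simp: potential_density_def renewal_density_nonpos)

lemma measurable_potential_density [measurable]: "potential_density \<in> borel_measurable borel"
  unfolding potential_density_def[abs_def] by measurable

text \<open>\<open>enn2real\<close> sends the value infinity to 0; since the Laplace transform is
  finite, this changes \<open>renewal_density\<close> only on a null set.\<close>

lemma laplace_potential_density:
  assumes "q > 0"
  shows "laplace (\<lambda>t. ennreal (potential_density t)) q = ennreal (1 / \<phi> q)"
proof -
  have "AE t in lborel. renewal_density t * ennreal (exp (- (q * t))) \<noteq> \<infinity>"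
    using laplace_renewal_density[OF assms] by (intro nn_integral_PInf_AE) (auto simp: laplace_def)
  then have "AE t in lborel. ennreal (potential_density t) = renewal_density t"
    by eventually_elim (auto simp: potential_density_def ennreal_mult_eq_top_iff less_top)
  then have "laplace (\<lambda>t. ennreal (potential_density t)) q = laplace renewal_density q"
    unfolding laplace_def by (intro nn_integral_cong_AE) (auto elim: eventually_mono)
  then show ?thesis using laplace_renewal_density[OF assms] by simp
qed

text \<open>The potential measure rescaled by \<open>T\<close>, with the factor
  \<open>\<phi> (1 / T)\<close> chosen so that the Laplace transform at \<open>q = 1\<close> equals
  1.\<close>

lemma laplace_potential_density_scaled:
  assumes T: "T > 0" and q: "q > 0"
  shows "laplace (\<lambda>t. ennreal (T * \<phi> (1 / T) * potential_density (T * t))) q = ennreal (\<phi> (1 / T) / \<phi> (q * (1 / T)))"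
proof -
  have pos: "\<phi> (1 / T) > 0" using T by (intro phi_pos) auto
  have "ennreal (1 / \<phi> (q / T)) = (\<integral>\<^sup>+t. ennreal (potential_density t) * ennreal (exp (- (q / T * t))) \<partial>lborel)"
    using laplace_potential_density[of "q / T"] T q by (simp add: laplace_def)
  also have "\<dots> = ennreal T * (\<integral>\<^sup>+t. ennreal (potential_density (T * t)) * ennreal (exp (- (q * t))) \<partial>lborel)"
    using T by (subst nn_integral_real_affine[where c=T and t=0]) auto
  finally have eq: "ennreal (1 / \<phi> (q / T)) = ennreal T * (\<integral>\<^sup>+t. ennreal (potential_density (T * t)) * ennreal (exp (- (q * t))) \<partial>lborel)" .
  have "laplace (\<lambda>t. ennreal (T * \<phi> (1 / T) * potential_density (T * t))) q =
     (\<integral>\<^sup>+t. ennreal (\<phi> (1 / T)) * (ennreal T * (ennreal (potential_density (T * t)) * ennreal (exp (- (q * t))))) \<partial>lborel)"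
    unfolding laplace_def using T pos
    by (intro nn_integral_cong) (simp add: ennreal_mult potential_density_nonneg mult_ac)
  also have "\<dots> = ennreal (\<phi> (1 / T)) * (ennreal T * (\<integral>\<^sup>+t. ennreal (potential_density (T * t)) * ennreal (exp (- (q * t))) \<partial>lborel))"
    by (simp add: nn_integral_cmult)
  also have "\<dots> = ennreal (\<phi> (1 / T) * (1 / \<phi> (q / T)))"
    unfolding eq[symmetric] using pos by (simp only: ennreal_mult'[symmetric] less_imp_le)
  finally show ?thesis by simp
qed

lemma laplace_bounded_potential_density:
  assumes T: "T > 0"
  shows "laplace_bounded (\<lambda>t. ennreal (T * \<phi> (1 / T) * potential_density (T * t)))"
  unfolding laplace_bounded_def
proof (intro conjI allI impI)
  fix q :: real assume q: "q > 0"
  show "laplace (\<lambda>t. ennreal (T * \<phi> (1 / T) * potential_density (T * t))) q \<le> ennreal (1 + 1 / q)"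
    unfolding laplace_potential_density_scaled[OF T q] using phi_ratio_bound[of "1 / T" q] T q by (intro ennreal_leI) auto
qed (use T in \<open>auto simp: potential_density_nonpos mult_nonneg_nonpos\<close>)

section \<open>The characteristic exponent\<close>

lemma log_exponent_eq: "\<xi> \<noteq> 0 \<Longrightarrow> log_exponent \<xi> = \<phi> ((norm \<xi>)\<^sup>2)"
  by (simp add: log_exponent_def \<phi>_def)

lemma log_exponent_0 [simp]: "log_exponent 0 = 0"
  by (simp add: log_exponent_def)

lemma log_exponent_pos: "\<xi> \<noteq> 0 \<Longrightarrow> log_exponent \<xi> > 0"
  by (simp add: log_exponent_eq phi_pos)

lemma log_exponent_nonneg: "log_exponent \<xi> \<ge> 0"
  using log_exponent_pos[of \<xi>] by (cases "\<xi> = 0") auto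

lemma measurable_log_exponent [measurable]: "log_exponent \<in> borel_measurable borel"
  unfolding log_exponent_def[abs_def] by measurable

lemma integrable_exp_log_exponent:
  assumes "t > 0"
  shows "integrable lborel (\<lambda>\<xi>::'a::euclidean_space. exp (- (t * log_exponent \<xi>)))"
proof (rule Bochner_Integration.integrable_bound)
  show "integrable lborel (\<lambda>\<xi>::'a. exp t * exp (- (t * norm \<xi>)))"
    by (intro integrable_mult_right integrable_exp_norm assms)
  show "AE \<xi>::'a in lborel. norm (exp (- (t * log_exponent \<xi>))) \<le> norm (exp t * exp (- (t * norm \<xi>)))"
  proof (intro AE_I2)
    fix \<xi> :: 'a
    have "norm \<xi> - 1 \<le> log_exponent \<xi>"
      using phi_ge_sqrt[of "norm \<xi>"] by (cases "\<xi> = 0") (auto simp: log_exponent_eq)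
    then have "t * (norm \<xi> - 1) \<le> t * log_exponent \<xi>" using assms by (intro mult_left_mono) auto
    then show "norm (exp (- (t * log_exponent \<xi>))) \<le> norm (exp t * exp (- (t * norm \<xi>)))"
      by (simp add: exp_add[symmetric] algebra_simps)
  qed
qed measurable

text \<open>\<open>heat_kernel s z\<close> is \<open>(2 \<pi>)\<^sup>d\<close> times the transition density at time \<open>s\<close> of the Brownian motion with
  characteristic exponent \<open>|\<xi>|\<^sup>2\<close>.\<close>

definition heat_kernel :: "real \<Rightarrow> 'a::euclidean_space \<Rightarrow> real" where
  "heat_kernel s z = (pi / s) powr (real DIM('a) / 2) * exp (- ((norm z)\<^sup>2 / (4 * s)))"

lemma heat_kernel_nonneg: "heat_kernel s z \<ge> 0"
  by (simp add: heat_kernel_def)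

lemma measurable_heat_kernel [measurable]: "(\<lambda>(s, z). heat_kernel s z) \<in> borel_measurable (borel \<Otimes>\<^sub>M borel)"
  unfolding heat_kernel_def by measurable

lemma measurable_heat_kernel_space [measurable]: "heat_kernel s \<in> borel_measurable borel"
  unfolding heat_kernel_def[abs_def] by measurable

text \<open>\<open>Q s t\<close> is \<open>(2 \<pi>)\<^sup>d\<close> times the density of the sum of \<open>X t\<close> and an independent Gaussian variable.\<close>

definition Q :: "real \<Rightarrow> real \<Rightarrow> 'a::euclidean_space \<Rightarrow> real" where
  "Q s t y = (\<integral>\<xi>. exp (- (s * (norm \<xi>)\<^sup>2)) * exp (- (t * log_exponent \<xi>)) * cos (\<xi> \<bullet> y) \<partial>lborel)"

lemma Q_0: "s > 0 \<Longrightarrow> Q s 0 y = heat_kernel s y"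
  unfolding Q_def heat_kernel_def using integral_gauss_cos[of s y] by simp

text \<open>The heat kernel is the Fourier integral of a Gaussian, so Fubini moves the expectation
  onto \<open>cos (\<xi> \<bullet> (y - Y \<omega>))\<close>. A real characteristic function means
  that the sine has mean 0, leaving \<open>\<psi> \<xi> * cos (\<xi> \<bullet> y)\<close>. The
  left-hand side makes the sign of the cosine integral evident.\<close>

lemma expectation_heat_kernel:
  fixes Y :: "'w \<Rightarrow> 'a::euclidean_space"
  assumes "prob_space M" and Y [measurable]: "Y \<in> borel_measurable M"
    and char: "\<And>\<xi>. (CLINT \<omega>|M. iexp (\<xi> \<bullet> Y \<omega>)) = complex_of_real (\<psi> \<xi>)"
    and s: "s > 0"
  shows "(\<integral>\<omega>. heat_kernel s (y - Y \<omega>) \<partial>M) = (\<integral>\<xi>. exp (- (s * (norm \<xi>)\<^sup>2)) * \<psi> \<xi> * cos (\<xi> \<bullet> y) \<partial>lborel)"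
proof -
  interpret prob_space M by fact
  interpret P: pair_sigma_finite M "lborel :: 'a measure" ..
  define f where "f = (\<lambda>(\<omega>, \<xi>). exp (- (s * (norm \<xi>)\<^sup>2)) * cos (\<xi> \<bullet> (y - Y \<omega>)))"
  define g where "g = (\<lambda>(\<omega>::'w, \<xi>::'a). exp (- (s * (norm \<xi>)\<^sup>2)))"
  have [measurable]: "f \<in> borel_measurable (M \<Otimes>\<^sub>M borel)" "g \<in> borel_measurable (M \<Otimes>\<^sub>M borel)"
    unfolding f_def g_def by measurable
  have "integrable (M \<Otimes>\<^sub>M lborel) f"
  proof (rule P.integrable_pair_bounded[where g=g])
    have "(\<integral>\<^sup>+\<xi>. ennreal (exp (- (s * (norm (\<xi>::'a))\<^sup>2))) \<partial>lborel) < \<infinity>"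
      using integrable_gauss[OF s, where 'a='a] by (simp add: integrable_iff_bounded)
    then show "(\<integral>\<^sup>+\<omega>. \<integral>\<^sup>+\<xi>. ennreal (g (\<omega>, \<xi>)) \<partial>lborel \<partial>M) < \<infinity>"
      by (simp add: g_def emeasure_space_1)
    show "\<bar>f (\<omega>, \<xi>)\<bar> \<le> g (\<omega>, \<xi>)" for \<omega> \<xi>
      by (simp add: f_def g_def abs_mult mult_left_le)
  qed measurable
  then have f_int: "integrable (M \<Otimes>\<^sub>M lborel) (\<lambda>(\<omega>, \<xi>). f (\<omega>, \<xi>))" by simp
  have inner: "(\<integral>\<omega>. f (\<omega>, \<xi>) \<partial>M) = exp (- (s * (norm \<xi>)\<^sup>2)) * \<psi> \<xi> * cos (\<xi> \<bullet> y)" for \<xi>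
  proof -
    have int: "integrable M (\<lambda>\<omega>. iexp (\<xi> \<bullet> Y \<omega>))"
      by (rule integrable_const_bound[where B=1]) auto
    have c: "(\<integral>\<omega>. cos (\<xi> \<bullet> Y \<omega>) \<partial>M) = \<psi> \<xi>"
      using integral_Re[OF int] unfolding char by (simp add: Re_exp)
    have s: "(\<integral>\<omega>. sin (\<xi> \<bullet> Y \<omega>) \<partial>M) = 0"
      using integral_Im[OF int] unfolding char by (simp add: Im_exp)
    have ic: "integrable M (\<lambda>\<omega>. cos (\<xi> \<bullet> Y \<omega>))" "integrable M (\<lambda>\<omega>. sin (\<xi> \<bullet> Y \<omega>))"
      by (rule integrable_const_bound[where B=1], auto)+
    have "(\<integral>\<omega>. f (\<omega>, \<xi>) \<partial>M) = (\<integral>\<omega>. exp (- (s * (norm \<xi>)\<^sup>2)) * cos (\<xi> \<bullet> y) * cos (\<xi> \<bullet> Y \<omega>)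
          + exp (- (s * (norm \<xi>)\<^sup>2)) * sin (\<xi> \<bullet> y) * sin (\<xi> \<bullet> Y \<omega>) \<partial>M)"
      by (simp add: f_def inner_diff_right cos_diff algebra_simps)
    also have "\<dots> = exp (- (s * (norm \<xi>)\<^sup>2)) * cos (\<xi> \<bullet> y) * (\<integral>\<omega>. cos (\<xi> \<bullet> Y \<omega>) \<partial>M)
          + exp (- (s * (norm \<xi>)\<^sup>2)) * sin (\<xi> \<bullet> y) * (\<integral>\<omega>. sin (\<xi> \<bullet> Y \<omega>) \<partial>M)"
      using ic by simp
    finally show ?thesis by (simp add: c s)
  qed
  have "(\<integral>\<omega>. heat_kernel s (y - Y \<omega>) \<partial>M) = (\<integral>\<omega>. \<integral>\<xi>. f (\<omega>, \<xi>) \<partial>lborel \<partial>M)"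
    unfolding f_def heat_kernel_def by (simp add: integral_gauss_cos[OF s])
  also have "\<dots> = (\<integral>\<xi>. \<integral>\<omega>. f (\<omega>, \<xi>) \<partial>M \<partial>lborel)"
    using P.Fubini_integral[OF f_int] by (simp only:)
  finally show ?thesis unfolding inner .
qed

lemma nn_integral_heat_kernel_1: "(\<integral>\<^sup>+z. ennreal (heat_kernel 1 (z::'a::euclidean_space)) \<partial>lborel) = ennreal ((2 * pi) ^ DIM('a))"
proof -
  have "(\<integral>\<^sup>+z. ennreal (heat_kernel 1 (z::'a)) \<partial>lborel) = ennreal (\<integral>z. heat_kernel 1 (z::'a) \<partial>lborel)"
    using integrable_gauss[of "1/4", where 'a='a]
    by (intro nn_integral_eq_integral) (auto simp: heat_kernel_def)
  also have "(\<integral>z. heat_kernel 1 (z::'a) \<partial>lborel) = pi powr (real DIM('a) / 2) * (pi / (1/4)) powr (real DIM('a) / 2)"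
    using integral_gauss_cos[of "1/4" "0::'a"] by (simp add: heat_kernel_def)
  also have "\<dots> = (2 * pi) powr (2 * (real DIM('a) / 2))"
    by (subst powr_powr[symmetric]) (simp add: powr_mult[symmetric] power2_eq_square mult_ac)
  also have "\<dots> = (2 * pi) ^ DIM('a)"
    by (subst powr_realpow[symmetric]) auto
  finally show ?thesis .
qed

text \<open>The substitution \<open>z = y - sqrt s *\<^sub>R x\<close> moves \<open>s\<close> from
  the kernel into the argument of \<open>f\<close>, so that \<open>s \<rightarrow> 0\<close> becomes
  a limit under a fixed weight.\<close>

lemma nn_integral_heat_kernel_rescale:
  fixes f :: "'a::euclidean_space \<Rightarrow> ennreal"
  assumes [measurable]: "f \<in> borel_measurable borel" and s: "s > 0"
  shows "(\<integral>\<^sup>+z. f z * ennreal (heat_kernel s (y - z)) \<partial>lborel) = (\<integral>\<^sup>+x. f (y - sqrt s *\<^sub>R x) * ennreal (heat_kernel 1 x) \<partial>lborel)"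
proof -
  have 1: "lborel = density (distr lborel borel (\<lambda>x::'a. y + (- sqrt s) *\<^sub>R x)) (\<lambda>_. \<bar>- sqrt s\<bar> ^ DIM('a))"
    using s by (intro lborel_affine) auto
  have 2: "sqrt s ^ DIM('a) * heat_kernel s (sqrt s *\<^sub>R x) = heat_kernel 1 x" for x :: 'a
  proof -
    have "sqrt s ^ DIM('a) = s powr (real DIM('a) / 2)"
      using s by (simp add: powr_half_sqrt[symmetric] powr_powr powr_realpow[symmetric] del: powr_realpow)
    then show ?thesis using s
      by (simp add: heat_kernel_def powr_divide power_mult_distrib)
  qed
  have "(\<integral>\<^sup>+z. f z * ennreal (heat_kernel s (y - z)) \<partial>lborel) =
      (\<integral>\<^sup>+x. ennreal (sqrt s ^ DIM('a)) * (f (y - sqrt s *\<^sub>R x) * ennreal (heat_kernel s (sqrt s *\<^sub>R x))) \<partial>lborel)"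
    using s by (subst 1) (simp add: nn_integral_density nn_integral_distr)
  also have "\<dots> = (\<integral>\<^sup>+x. f (y - sqrt s *\<^sub>R x) * ennreal (heat_kernel 1 x) \<partial>lborel)"
    using s by (intro nn_integral_cong) (simp add: 2[symmetric] ennreal_mult heat_kernel_nonneg mult_ac)
  finally show ?thesis .
qed

text \<open>The continuous density is recovered from its Gaussian regularisations. Fatou's lemma first shows
  that it is bounded by \<open>B\<close>, which then justifies dominated convergence.\<close>

lemma continuous_density_eq_limit:
  fixes f :: "'a::euclidean_space \<Rightarrow> real"
  assumes cont: "continuous_on UNIV f" and f: "\<And>z. f z \<ge> 0"
    and s: "\<And>n. s n > (0::real)" "s \<longlonglongrightarrow> 0"
    and k: "\<And>n y. (\<integral>\<^sup>+z. ennreal (f z) * ennreal (heat_kernel (s n) (y - z)) \<partial>lborel) = ennreal (k n y)"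
    and L: "\<And>y. (\<lambda>n. k n y) \<longlonglongrightarrow> L y" and B: "\<And>y. L y \<le> B" and L0: "\<And>y. L y \<ge> 0"
  shows "(2 * pi) ^ DIM('a) * f y = L y"
proof -
  have [measurable]: "f \<in> borel_measurable borel"
    using cont by (rule borel_measurable_continuous_onI)
  define c where "c = (2 * pi) ^ DIM('a)"
  have c: "c > 0" by (simp add: c_def)
  have k': "(\<integral>\<^sup>+x. ennreal (f (y - sqrt (s n) *\<^sub>R x)) * ennreal (heat_kernel 1 x) \<partial>lborel) = ennreal (k n y)" for n y
    using nn_integral_heat_kernel_rescale[of "\<lambda>z. ennreal (f z)" "s n" y] s k by simp
  have lim: "(\<lambda>n. ennreal (f (y - sqrt (s n) *\<^sub>R x)) * ennreal (heat_kernel 1 x)) \<longlonglongrightarrow> ennreal (f y) * ennreal (heat_kernel 1 x)" for x y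
  proof -
    have "(\<lambda>n. y - sqrt (s n) *\<^sub>R x) \<longlonglongrightarrow> y - sqrt 0 *\<^sub>R x"
      by (intro tendsto_intros s)
    then have "(\<lambda>n. f (y - sqrt (s n) *\<^sub>R x)) \<longlonglongrightarrow> f y"
      using cont isCont_tendsto_compose[of y f] by (simp add: continuous_on_eq_continuous_at)
    then show ?thesis by (intro tendsto_mult_ennreal tendsto_ennrealI tendsto_const) auto
  qed
  have I: "(\<integral>\<^sup>+x. ennreal (f y) * ennreal (heat_kernel 1 (x::'a)) \<partial>lborel) = ennreal (c * f y)" for y
    using f by (simp add: nn_integral_cmult nn_integral_heat_kernel_1 c_def ennreal_mult' mult.commute)
  have Lim: "(\<lambda>n. ennreal (k n y)) \<longlonglongrightarrow> ennreal (L y)" for y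
    by (intro tendsto_ennrealI L)
  have le: "ennreal (c * f y) \<le> ennreal (L y)" for y
  proof -
    have "ennreal (c * f y) = (\<integral>\<^sup>+x. liminf (\<lambda>n. ennreal (f (y - sqrt (s n) *\<^sub>R x)) * ennreal (heat_kernel 1 x)) \<partial>lborel)"
      unfolding I[symmetric]
      by (intro nn_integral_cong lim_imp_Liminf[OF sequentially_bot lim, symmetric])
    also have "\<dots> \<le> liminf (\<lambda>n. \<integral>\<^sup>+x. ennreal (f (y - sqrt (s n) *\<^sub>R x)) * ennreal (heat_kernel 1 x) \<partial>lborel)"
      by (rule nn_integral_liminf) measurable
    also have "\<dots> = ennreal (L y)"
      unfolding k' using Lim by (simp add: lim_imp_Liminf)
    finally show ?thesis .
  qed
  have "c * f y \<le> B" for y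
    using le[of y] L0[of y] B[of y] by (simp add: ennreal_le_iff)
  then have fB: "f y \<le> B / c" for y
    using c by (simp add: pos_le_divide_eq mult.commute)
  have "(\<lambda>n. \<integral>\<^sup>+x. ennreal (f (y - sqrt (s n) *\<^sub>R x)) * ennreal (heat_kernel 1 x) \<partial>lborel) \<longlonglongrightarrow>
     (\<integral>\<^sup>+x. ennreal (f y) * ennreal (heat_kernel 1 (x::'a)) \<partial>lborel)"
  proof (rule nn_integral_dominated_convergence)
    show "(\<integral>\<^sup>+x. ennreal (B / c) * ennreal (heat_kernel 1 (x::'a)) \<partial>lborel) < \<infinity>"
      by (simp add: nn_integral_cmult nn_integral_heat_kernel_1 ennreal_mult_less_top)
    show "AE x in lborel. ennreal (f (y - sqrt (s n) *\<^sub>R x)) * ennreal (heat_kernel 1 x) \<le> ennreal (B / c) * ennreal (heat_kernel 1 x)" for n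
      by (intro AE_I2 mult_right_mono ennreal_leI fB) simp
  qed (simp_all add: lim)
  then have "ennreal (c * f y) = ennreal (L y)"
    unfolding k' I using Lim by (rule LIMSEQ_unique)
  moreover have "0 \<le> c * f y" using c f[of y] by simp
  ultimately show ?thesis using L0[of y] unfolding c_def by (simp only: ennreal_inj)
qed

section \<open>Limits of the regularised kernels and integrability of the inverse exponent\<close>

lemma measurable_Q [measurable]: "(\<lambda>t. Q s t y) \<in> borel_measurable borel" "(\<lambda>s. Q s t y) \<in> borel_measurable borel"
  unfolding Q_def by measurable

lemma Q_tendsto_fst:
  assumes t: "t > 0" and s: "\<And>n. s n \<ge> 0" "s \<longlonglongrightarrow> 0"
  shows "(\<lambda>n. Q (s n) t y) \<longlonglongrightarrow> Q 0 t y"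
  unfolding Q_def
proof (rule integral_dominated_convergence)
  show "integrable lborel (\<lambda>\<xi>::'a. exp (- (t * log_exponent \<xi>)))"
    by (rule integrable_exp_log_exponent[OF t])
  show "AE \<xi> in lborel. (\<lambda>n. exp (- (s n * (norm \<xi>)\<^sup>2)) * exp (- (t * log_exponent \<xi>)) * cos (\<xi> \<bullet> y))
      \<longlonglongrightarrow> exp (- (0 * (norm \<xi>)\<^sup>2)) * exp (- (t * log_exponent \<xi>)) * cos (\<xi> \<bullet> y)"
    by (intro AE_I2 tendsto_intros s)
  show "AE \<xi> in lborel. norm (exp (- (s n * (norm \<xi>)\<^sup>2)) * exp (- (t * log_exponent \<xi>)) * cos (\<xi> \<bullet> y))
      \<le> exp (- (t * log_exponent \<xi>))" for n
    using s(1)[of n] by (intro AE_I2) (simp add: abs_mult mult_le_one mult_left_le_one_le mult.assoc mult.left_commute[of "exp (- (s n * _))"] mult_left_le)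
qed measurable

lemma Q_tendsto_snd:
  assumes s: "s > 0" and t: "\<And>n. t n \<ge> 0" "t \<longlonglongrightarrow> 0"
  shows "(\<lambda>n. Q s (t n) y) \<longlonglongrightarrow> Q s 0 y"
  unfolding Q_def
proof (rule integral_dominated_convergence)
  show "integrable lborel (\<lambda>\<xi>::'a. exp (- (s * (norm \<xi>)\<^sup>2)))"
    by (rule integrable_gauss[OF s])
  show "AE \<xi> in lborel. (\<lambda>n. exp (- (s * (norm \<xi>)\<^sup>2)) * exp (- (t n * log_exponent \<xi>)) * cos (\<xi> \<bullet> y))
      \<longlonglongrightarrow> exp (- (s * (norm \<xi>)\<^sup>2)) * exp (- (0 * log_exponent \<xi>)) * cos (\<xi> \<bullet> y)"
    by (intro AE_I2 tendsto_intros t)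
  show "AE \<xi> in lborel. norm (exp (- (s * (norm \<xi>)\<^sup>2)) * exp (- (t n * log_exponent \<xi>)) * cos (\<xi> \<bullet> y))
      \<le> exp (- (s * (norm \<xi>)\<^sup>2))" for n
    using t(1)[of n] by (intro AE_I2) (simp add: abs_mult mult_le_one mult.assoc mult_left_le log_exponent_nonneg)
qed measurable

lemma Q_le_Q_0:
  fixes y :: "'a::euclidean_space"
  assumes t: "t > 0"
  shows "Q 0 t y \<le> Q 0 t (0::'a)"
proof -
  have int: "integrable lborel (\<lambda>\<xi>::'a. exp (- (t * log_exponent \<xi>)))"
    by (rule integrable_exp_log_exponent[OF t])
  have int_cos: "integrable lborel (\<lambda>\<xi>. exp (- (0 * (norm \<xi>)\<^sup>2)) * exp (- (t * log_exponent \<xi>)) * cos (\<xi> \<bullet> z))" for z :: 'a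
    by (rule Bochner_Integration.integrable_bound[OF int]) (auto simp: abs_mult mult_left_le)
  show ?thesis
    unfolding Q_def by (rule Bochner_Integration.integral_mono[OF int_cos int_cos]) (simp add: mult_left_le)
qed

text \<open>The instance \<open>T = 1\<close>, \<open>k = 0\<close> of the weighted bound, with the
  constant \<open>\<phi> 1 > 0\<close> divided out.\<close>

lemma potential_density_weight_finite:
  assumes "a > 1"
  shows "(\<integral>\<^sup>+t. ennreal (potential_density t) * ennreal ((1 + t) powr (- a)) \<partial>lborel) < \<infinity>"
proof -
  have pos: "\<phi> 1 > 0" by (rule phi_pos) simp
  have "(\<integral>\<^sup>+t. ennreal (1 * \<phi> (1 / 1) * potential_density (1 * t)) * ennreal ((1 + t) powr (- a) * exp (- (0 * t))) \<partial>lborel) < \<infinity>"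
    by (rule powr_weight_finite[OF laplace_bounded_potential_density]) (use assms in auto)
  also have "(\<integral>\<^sup>+t. ennreal (1 * \<phi> (1 / 1) * potential_density (1 * t)) * ennreal ((1 + t) powr (- a) * exp (- (0 * t))) \<partial>lborel)
     = (\<integral>\<^sup>+t. ennreal (\<phi> 1) * (ennreal (potential_density t) * ennreal ((1 + t) powr (- a))) \<partial>lborel)"
    using pos by (intro nn_integral_cong) (simp add: ennreal_mult' mult.assoc)
  also have "\<dots> = ennreal (\<phi> 1) * (\<integral>\<^sup>+t. ennreal (potential_density t) * ennreal ((1 + t) powr (- a)) \<partial>lborel)"
    by (rule nn_integral_cmult) measurable
  finally show ?thesis using pos by (auto simp: ennreal_mult_less_top)
qed

text \<open>The singularity at the origin is handled without polar coordinates: writing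
  \<open>1 / log_exponent\<close> as the Laplace transform of the potential density at
  \<open>|\<xi>|\<^sup>2\<close> and integrating the Gaussian first leaves
  \<open>(pi / (s + t)) powr (d / 2)\<close> against the potential density, and
  \<open>d / 2 > 1\<close> makes that finite.\<close>

lemma integrable_gauss_inverse:
  assumes d: "DIM('a::euclidean_space) \<ge> 3" and s: "s > 0"
  shows "integrable lborel (\<lambda>\<xi>::'a. exp (- (s * (norm \<xi>)\<^sup>2)) * (1 / log_exponent \<xi>))"
proof (rule integrableI_nonneg)
  define D where "D = real DIM('a) / 2"
  \<comment> \<open>Chosen so that \<open>1 / (s + t) \<le> (1 + 1 / s) / (1 + t)\<close> yields the
    standard weight.\<close>
  define C where "C = (pi * (1 + 1 / s)) powr D"
  have AE0: "AE \<xi>::'a in lborel. \<xi> \<noteq> 0" by (rule AE_lborel_singleton)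
  have "(\<integral>\<^sup>+\<xi>. ennreal (exp (- (s * (norm (\<xi>::'a))\<^sup>2)) * (1 / log_exponent \<xi>)) \<partial>lborel) =
     (\<integral>\<^sup>+\<xi>. \<integral>\<^sup>+t. ennreal (potential_density t) * ennreal (exp (- ((s + t) * (norm (\<xi>::'a))\<^sup>2))) \<partial>lborel \<partial>lborel)"
  proof (rule nn_integral_cong_AE, use AE0 in eventually_elim)
    case (elim \<xi>)
    have "ennreal (exp (- (s * (norm \<xi>)\<^sup>2)) * (1 / log_exponent \<xi>)) =
        ennreal (exp (- (s * (norm \<xi>)\<^sup>2))) * laplace (\<lambda>t. ennreal (potential_density t)) ((norm \<xi>)\<^sup>2)"
      using elim by (subst laplace_potential_density) (auto simp: log_exponent_eq ennreal_mult' [symmetric])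
    also have "\<dots> = (\<integral>\<^sup>+t. ennreal (exp (- (s * (norm \<xi>)\<^sup>2))) * (ennreal (potential_density t) * ennreal (exp (- ((norm \<xi>)\<^sup>2 * t)))) \<partial>lborel)"
      unfolding laplace_def by (rule nn_integral_cmult[symmetric]) measurable
    also have "\<dots> = (\<integral>\<^sup>+t. ennreal (potential_density t) * ennreal (exp (- ((s + t) * (norm \<xi>)\<^sup>2))) \<partial>lborel)"
      by (intro nn_integral_cong)
         (simp add: ennreal_mult[symmetric] potential_density_nonneg exp_add[symmetric] algebra_simps)
    finally show ?case .
  qed
  also have "\<dots> = (\<integral>\<^sup>+t. \<integral>\<^sup>+\<xi>. ennreal (potential_density t) * ennreal (exp (- ((s + t) * (norm (\<xi>::'a))\<^sup>2))) \<partial>lborel \<partial>lborel)"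
    by (rule lborel_pair.Fubini'[symmetric]) measurable
  also have "\<dots> \<le> (\<integral>\<^sup>+t. ennreal C * (ennreal (potential_density t) * ennreal ((1 + t) powr (- D))) \<partial>lborel)"
  proof (rule nn_integral_mono)
    fix t :: real
    show "(\<integral>\<^sup>+\<xi>. ennreal (potential_density t) * ennreal (exp (- ((s + t) * (norm (\<xi>::'a))\<^sup>2))) \<partial>lborel)
       \<le> ennreal C * (ennreal (potential_density t) * ennreal ((1 + t) powr (- D)))"
    proof (cases "t > 0")
      case True
      have st: "s + t > 0" using True s by simp
      have "(\<integral>\<^sup>+\<xi>. ennreal (exp (- ((s + t) * (norm (\<xi>::'a))\<^sup>2))) \<partial>lborel) = ennreal ((pi / (s + t)) powr D)"
        using integrable_gauss[OF st, where 'a='a] integral_gauss_cos[OF st, of "0::'a"]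
        by (subst nn_integral_eq_integral) (auto simp: D_def)
      moreover have "(pi / (s + t)) powr D \<le> C * (1 + t) powr (- D)"
      proof -
        have "pi / (s + t) \<le> pi * (1 + 1 / s) / (1 + t)"
          using True s st by (simp add: divide_simps) (simp add: algebra_simps)
        then have "(pi / (s + t)) powr D \<le> (pi * (1 + 1 / s) / (1 + t)) powr D"
          using st by (intro powr_mono2) (auto simp: D_def)
        also have "\<dots> = C * (1 + t) powr (- D)"
          using True s by (simp add: C_def powr_divide powr_minus_divide)
        finally show ?thesis .
      qed
      moreover have "C \<ge> 0" by (simp add: C_def)
      ultimately show ?thesis
        by (subst nn_integral_cmult) (auto simp: mult.left_commute[of "ennreal C"] ennreal_mult[symmetric] intro!: mult_left_mono ennreal_leI)
    qed (simp add: potential_density_nonpos)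
  qed
  also have "\<dots> = ennreal C * (\<integral>\<^sup>+t. ennreal (potential_density t) * ennreal ((1 + t) powr (- D)) \<partial>lborel)"
    by (rule nn_integral_cmult) measurable
  also have "\<dots> < \<infinity>"
    using potential_density_weight_finite[of D] d by (simp add: ennreal_mult_less_top D_def)
  finally show "(\<integral>\<^sup>+\<xi>. ennreal (exp (- (s * (norm (\<xi>::'a))\<^sup>2)) * (1 / log_exponent \<xi>)) \<partial>lborel) < \<infinity>" .
qed (auto simp: log_exponent_nonneg)

text \<open>On the unit ball the Gaussian case dominates, the factor \<open>exp 1\<close> making up
  for \<open>exp (- |\<xi>|\<^sup>2)\<close>; outside it
  \<open>1 / log_exponent \<xi> \<le> 1 / \<phi> 1\<close> by monotonicity.\<close>

lemma integrable_exp_inverse: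
  assumes d: "DIM('a::euclidean_space) \<ge> 3" and e: "e > 0"
  shows "integrable lborel (\<lambda>\<xi>::'a. exp (- (e * log_exponent \<xi>)) * (1 / log_exponent \<xi>))"
proof (rule Bochner_Integration.integrable_bound)
  show "integrable lborel (\<lambda>\<xi>::'a. exp 1 * (exp (- (1 * (norm \<xi>)\<^sup>2)) * (1 / log_exponent \<xi>)) +
      1 / \<phi> 1 * exp (- (e * log_exponent \<xi>)))"
    by (intro Bochner_Integration.integrable_add integrable_mult_right
         integrable_gauss_inverse integrable_exp_log_exponent d e zero_less_one)
  show "AE \<xi>::'a in lborel. norm (exp (- (e * log_exponent \<xi>)) * (1 / log_exponent \<xi>)) \<le>
     norm (exp 1 * (exp (- (1 * (norm \<xi>)\<^sup>2)) * (1 / log_exponent \<xi>)) + 1 / \<phi> 1 * exp (- (e * log_exponent \<xi>)))"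
  proof (intro AE_I2)
    fix \<xi> :: 'a
    have pos: "\<phi> 1 > 0" by (rule phi_pos) simp
    have nn: "exp 1 * (exp (- (1 * (norm \<xi>)\<^sup>2)) * (1 / log_exponent \<xi>)) \<ge> 0" "1 / \<phi> 1 * exp (- (e * log_exponent \<xi>)) \<ge> 0"
      using pos by (auto simp: log_exponent_nonneg)
    have "exp (- (e * log_exponent \<xi>)) * (1 / log_exponent \<xi>) \<le>
      exp 1 * (exp (- (1 * (norm \<xi>)\<^sup>2)) * (1 / log_exponent \<xi>)) + 1 / \<phi> 1 * exp (- (e * log_exponent \<xi>))"
    proof (cases "norm \<xi> \<le> 1")
      case True
      have "exp (- (e * log_exponent \<xi>)) \<le> 1" using e by (simp add: log_exponent_nonneg)
      also have "1 \<le> exp 1 * exp (- (1 * (norm \<xi>)\<^sup>2))"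
        using True by (simp add: exp_add[symmetric] power_le_one)
      finally have "exp (- (e * log_exponent \<xi>)) * (1 / log_exponent \<xi>) \<le> exp 1 * exp (- (1 * (norm \<xi>)\<^sup>2)) * (1 / log_exponent \<xi>)"
        by (rule mult_right_mono) (simp add: log_exponent_nonneg)
      then show ?thesis using nn(2) by (simp only: mult.assoc)
    next
      case False
      then have "\<phi> 1 \<le> \<phi> ((norm \<xi>)\<^sup>2)" by (intro phi_mono) auto
      also have "\<dots> = log_exponent \<xi>" using False by (subst log_exponent_eq) auto
      finally have "1 / log_exponent \<xi> \<le> 1 / \<phi> 1" using pos by (intro divide_left_mono) auto
      then have "exp (- (e * log_exponent \<xi>)) * (1 / log_exponent \<xi>) \<le> exp (- (e * log_exponent \<xi>)) * (1 / \<phi> 1)"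
        by (intro mult_left_mono) auto
      then show ?thesis using nn(1) by (simp only: mult.commute[of _ "exp (- (e * log_exponent \<xi>))"])
    qed
    moreover have "exp (- (e * log_exponent \<xi>)) * (1 / log_exponent \<xi>) \<ge> 0" by (simp add: log_exponent_nonneg)
    ultimately show "norm (exp (- (e * log_exponent \<xi>)) * (1 / log_exponent \<xi>)) \<le>
     norm (exp 1 * (exp (- (1 * (norm \<xi>)\<^sup>2)) * (1 / log_exponent \<xi>)) + 1 / \<phi> 1 * exp (- (e * log_exponent \<xi>)))"
      unfolding real_norm_def by linarith
  qed
qed measurable

text \<open>Both sides are the cosine integral of \<open>exp (- s |\<xi>|\<^sup>2 - e * log_exponent
  \<xi>) / log_exponent \<xi>\<close>. The inverse exponent is expanded in two ways: as Laplace
  transform of the potential density at \<open>|\<xi>|\<^sup>2\<close>, which adds to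
  \<open>s\<close>, and as integral of \<open>exp (- t * log_exponent \<xi>)\<close> over
  \<open>t > 0\<close>, which adds to \<open>e\<close>. The sign conditions turn signed integrals
  into nonnegative ones.\<close>

lemma nn_integral_Q_eq:
  fixes y :: "'a::euclidean_space"
  assumes int: "integrable lborel (\<lambda>\<xi>::'a. exp (- (s * (norm \<xi>)\<^sup>2)) * exp (- (e * log_exponent \<xi>)) * (1 / log_exponent \<xi>))"
    and Q1: "\<And>t. t > 0 \<Longrightarrow> Q (s + t) e y \<ge> 0" and Q2: "\<And>t. t > 0 \<Longrightarrow> Q s (e + t) y \<ge> 0"
  shows "(\<integral>\<^sup>+t. ennreal (potential_density t) * ennreal (Q (s + t) e y) \<partial>lborel) =
         (\<integral>\<^sup>+t. indicator {0<..} t * ennreal (Q s (e + t) y) \<partial>lborel)"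
proof -
  define w where "w \<xi> = exp (- (s * (norm \<xi>)\<^sup>2)) * exp (- (e * log_exponent \<xi>))" for \<xi> :: 'a
  have [measurable]: "w \<in> borel_measurable borel" unfolding w_def[abs_def] by measurable
  have wint: "integrable lborel (\<lambda>\<xi>. w \<xi> * (1 / log_exponent \<xi>))" using int by (simp add: w_def)
  have eq1: "(\<integral>\<xi>. w \<xi> * exp (- ((norm \<xi>)\<^sup>2 * t)) * cos (\<xi> \<bullet> y) \<partial>lborel) = Q (s + t) e y" for t
    unfolding w_def Q_def
    by (intro Bochner_Integration.integral_cong) (auto simp: exp_add[symmetric] algebra_simps)
  have eq2: "(\<integral>\<xi>. w \<xi> * exp (- (log_exponent \<xi> * t)) * cos (\<xi> \<bullet> y) \<partial>lborel) = Q s (e + t) y" for t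
    unfolding w_def Q_def
    by (intro Bochner_Integration.integral_cong) (auto simp: exp_add[symmetric] algebra_simps)
  have L1: "laplace (\<lambda>t. ennreal (potential_density t)) ((norm \<xi>)\<^sup>2) = ennreal (1 / log_exponent \<xi>)" if "\<xi> \<noteq> 0" for \<xi> :: 'a
    using that by (subst laplace_potential_density) (auto simp: log_exponent_eq)
  have L2: "laplace (\<lambda>t. ennreal (indicator {0<..} t)) (log_exponent \<xi>) = ennreal (1 / log_exponent \<xi>)" if "\<xi> \<noteq> 0" for \<xi> :: 'a
    using nn_integral_exp_pos[OF log_exponent_pos[OF that]] by (simp add: laplace_def ennreal_indicator)
  have m: "(\<lambda>\<xi>::'a. (norm \<xi>)\<^sup>2) \<in> borel_measurable borel" "(\<lambda>\<xi>::'a. 1 / log_exponent \<xi>) \<in> borel_measurable borel"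
    "(indicator {0<..} :: real \<Rightarrow> real) \<in> borel_measurable borel"
    by measurable
  have w0: "w \<xi> \<ge> 0" for \<xi> by (simp add: w_def)
  have P0: "1 / log_exponent \<xi> \<ge> 0" for \<xi> :: 'a by (simp add: log_exponent_nonneg)
  have 1: "integrable lborel (\<lambda>t. potential_density t * Q (s + t) e y)"
    "(\<integral>t. potential_density t * Q (s + t) e y \<partial>lborel) = (\<integral>\<xi>. w \<xi> * (1 / log_exponent \<xi>) * cos (\<xi> \<bullet> y) \<partial>lborel)"
    using integrable_laplace_mixture[of w "\<lambda>\<xi>. (norm \<xi>)\<^sup>2" "\<lambda>\<xi>. 1 / log_exponent \<xi>" potential_density y, OF _ m(1,2) _ w0 potential_density_nonneg P0 L1 wint]
      integral_laplace_mixture[of w "\<lambda>\<xi>. (norm \<xi>)\<^sup>2" "\<lambda>\<xi>. 1 / log_exponent \<xi>" potential_density y, OF _ m(1,2) _ w0 potential_density_nonneg P0 L1 wint]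
    unfolding eq1 by auto
  have 2: "integrable lborel (\<lambda>t. indicator {0<..} t * Q s (e + t) y)"
    "(\<integral>t. indicator {0<..} t * Q s (e + t) y \<partial>lborel) = (\<integral>\<xi>. w \<xi> * (1 / log_exponent \<xi>) * cos (\<xi> \<bullet> y) \<partial>lborel)"
    using integrable_laplace_mixture[of w log_exponent "\<lambda>\<xi>. 1 / log_exponent \<xi>" "indicator {0<..}" y, OF _ _ m(2,3) w0 _ P0 L2 wint]
      integral_laplace_mixture[of w log_exponent "\<lambda>\<xi>. 1 / log_exponent \<xi>" "indicator {0<..}" y, OF _ _ m(2,3) w0 _ P0 L2 wint]
    unfolding eq2 by auto
  have n1: "potential_density t * Q (s + t) e y \<ge> 0" for t
    using Q1[of t] potential_density_nonneg[of t] by (cases "t > 0") (auto simp: potential_density_nonpos)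
  have n2: "indicator {0<..} t * Q s (e + t) y \<ge> 0" for t :: real
    using Q2[of t] by (auto split: split_indicator)
  have "(\<integral>\<^sup>+t. ennreal (potential_density t) * ennreal (Q (s + t) e y) \<partial>lborel) = (\<integral>\<^sup>+t. ennreal (potential_density t * Q (s + t) e y) \<partial>lborel)"
    by (intro nn_integral_cong) (simp add: ennreal_mult' potential_density_nonneg)
  also have "\<dots> = ennreal (\<integral>\<xi>. w \<xi> * (1 / log_exponent \<xi>) * cos (\<xi> \<bullet> y) \<partial>lborel)"
    using 1 n1 by (subst nn_integral_eq_integral) auto
  also have "\<dots> = (\<integral>\<^sup>+t. ennreal (indicator {0<..} t * Q s (e + t) y) \<partial>lborel)"
    using 2 n2 by (subst nn_integral_eq_integral) auto
  also have "\<dots> = (\<integral>\<^sup>+t. indicator {0<..} t * ennreal (Q s (e + t) y) \<partial>lborel)"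
    by (intro nn_integral_cong) (auto split: split_indicator)
  finally show ?thesis .
qed

text \<open>Off the origin, \<open>exp (- |y|\<^sup>2 / (4 * a))\<close> defeats the blow-up of the
  power of \<open>1 / a\<close> as \<open>a \<rightarrow> 0\<close>; this is
  \<open>1 + x \<le> exp x\<close> at \<open>x = b / (a * D)\<close>, raised to the power
  \<open>D\<close>.\<close>

lemma heat_kernel_bound:
  fixes y :: "'a::euclidean_space"
  assumes "y \<noteq> 0"
  obtains C where "C \<ge> 0" "\<And>a. a > 0 \<Longrightarrow> heat_kernel a y \<le> C * (1 + a) powr (- (real DIM('a) / 2))"
proof -
  define D where "D = real DIM('a) / 2"
  have D: "D > 0" by (simp add: D_def)
  define b where "b = (norm y)\<^sup>2 / 4"
  have b: "b > 0" using assms by (simp add: b_def)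
  \<comment> \<open>Then \<open>K * (1 + b / (a * D))\<close> contains the terms 1 and
    \<open>1 / a\<close>, and its other terms are positive.\<close>
  define K where "K = 1 + D / b"
  have K: "K > 0" using D b by (simp add: K_def add_pos_pos)
  show ?thesis
  proof
    show "(pi * K) powr D \<ge> 0" by simp
    fix a :: real assume a: "a > 0"
    have "1 + 1 / a \<le> K * (1 + b / (a * D))"
      using a b D by (simp add: K_def field_simps)
    also have "\<dots> \<le> K * exp (b / (a * D))"
      using K by (intro mult_left_mono exp_ge_add_one_self) auto
    finally have "(1 + 1 / a) powr D \<le> (K * exp (b / (a * D))) powr D"
      using a D by (intro powr_mono2) (auto intro: add_nonneg_nonneg)
    also have "\<dots> = K powr D * exp (b / a)"
      using K D by (simp add: powr_mult exp_powr_real)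
    finally have le: "(1 + 1 / a) powr D * exp (- (b / a)) \<le> K powr D"
      by (simp add: exp_minus field_simps)
    have "heat_kernel a y = pi powr D * ((1 + 1 / a) powr D * exp (- (b / a))) * (1 + a) powr (- D)"
    proof -
      have "1 + 1 / a = (1 + a) / a" using a by (simp add: field_simps)
      then have "pi powr D * (1 + 1 / a) powr D * (1 + a) powr (- D) = (pi / a) powr D"
        using a by (simp add: powr_divide powr_minus field_simps)
      then show ?thesis using a by (simp add: heat_kernel_def D_def b_def mult_ac)
    qed
    also have "\<dots> \<le> pi powr D * K powr D * (1 + a) powr (- D)"
      using le by (intro mult_right_mono mult_left_mono) auto
    finally show "heat_kernel a y \<le> (pi * K) powr D * (1 + a) powr (- (real DIM('a) / 2))"
      using K by (simp add: powr_mult D_def)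
  qed
qed

lemma nn_integral_Q_eq_potential:
  fixes y :: "'a::euclidean_space"
  assumes d: "DIM('a) \<ge> 3" and y: "y \<noteq> 0"
    and Qnn: "\<And>s t. s \<ge> 0 \<Longrightarrow> t \<ge> 0 \<Longrightarrow> s + t > 0 \<Longrightarrow> Q s t y \<ge> 0"
  shows "(\<integral>\<^sup>+t. indicator {0<..} t * ennreal (Q 0 t y) \<partial>lborel) =
    (\<integral>\<^sup>+t. ennreal (potential_density t) * ennreal (heat_kernel t y) \<partial>lborel)"
proof (rule antisym)
  define s where "s n = 1 / real (Suc n)" for n
  have s: "s n > 0" "s n \<ge> 0" "s \<longlonglongrightarrow> 0" for n
    unfolding s_def using LIMSEQ_inverse_real_of_nat by (auto simp: inverse_eq_divide)
  define D where "D = real DIM('a) / 2"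
  have heat_kernel_s: "(\<integral>\<^sup>+t. indicator {0<..} t * ennreal (Q (s n) t y) \<partial>lborel) =
      (\<integral>\<^sup>+t. ennreal (potential_density t) * ennreal (heat_kernel (s n + t) y) \<partial>lborel)" for n
  proof -
    have "(\<integral>\<^sup>+t. ennreal (potential_density t) * ennreal (Q (s n + t) 0 y) \<partial>lborel) =
         (\<integral>\<^sup>+t. indicator {0<..} t * ennreal (Q (s n) (0 + t) y) \<partial>lborel)"
      using integrable_gauss_inverse[OF d s(1)] s(1)[of n] by (intro nn_integral_Q_eq Qnn) auto
    moreover have "ennreal (potential_density t) * ennreal (Q (s n + t) 0 y) = ennreal (potential_density t) * ennreal (heat_kernel (s n + t) y)" for t
      using s(1)[of n] by (cases "t > 0") (auto simp: potential_density_nonpos Q_0)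
    ultimately show ?thesis by simp
  qed
  obtain C where C: "C \<ge> 0" "\<And>a. a > 0 \<Longrightarrow> heat_kernel a y \<le> C * (1 + a) powr (- D)"
    using heat_kernel_bound[OF y] unfolding D_def by blast
  \<comment> \<open>For \<open>y \<noteq> 0\<close> the heat kernels at the shifted times
    \<open>s n + t\<close> share an integrable majorant, so the potential side truly converges; only
    the time side is left to Fatou's lemma.\<close>
  have lim: "(\<lambda>n. \<integral>\<^sup>+t. ennreal (potential_density t) * ennreal (heat_kernel (s n + t) y) \<partial>lborel) \<longlonglongrightarrow>
     (\<integral>\<^sup>+t. ennreal (potential_density t) * ennreal (heat_kernel t y) \<partial>lborel)"
  proof (rule nn_integral_dominated_convergence)
    show "(\<integral>\<^sup>+t. ennreal C * (ennreal (potential_density t) * ennreal ((1 + t) powr (- D))) \<partial>lborel) < \<infinity>"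
      using potential_density_weight_finite[of D] d by (subst nn_integral_cmult) (auto simp: ennreal_mult_less_top D_def)
    show "AE t in lborel. ennreal (potential_density t) * ennreal (heat_kernel (s n + t) y) \<le> ennreal C * (ennreal (potential_density t) * ennreal ((1 + t) powr (- D)))" for n
    proof (intro AE_I2)
      fix t :: real
      show "ennreal (potential_density t) * ennreal (heat_kernel (s n + t) y) \<le> ennreal C * (ennreal (potential_density t) * ennreal ((1 + t) powr (- D)))"
      proof (cases "t > 0")
        case True
        have "heat_kernel (s n + t) y \<le> C * (1 + (s n + t)) powr (- D)" using True s(1)[of n] by (intro C) auto
        also have "\<dots> \<le> C * (1 + t) powr (- D)"
          using True s(1)[of n] C(1) by (intro mult_left_mono powr_mono2') (auto simp: D_def)
        finally have "ennreal (heat_kernel (s n + t) y) \<le> ennreal C * ennreal ((1 + t) powr (- D))"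
          using C(1) by (simp add: ennreal_mult'[symmetric] ennreal_leI)
        then show ?thesis
          by (subst mult.left_commute) (rule mult_left_mono, simp_all)
      qed (simp add: potential_density_nonpos)
    qed
    show "AE t in lborel. (\<lambda>n. ennreal (potential_density t) * ennreal (heat_kernel (s n + t) y)) \<longlonglongrightarrow> ennreal (potential_density t) * ennreal (heat_kernel t y)"
    proof (intro AE_I2)
      fix t :: real
      show "(\<lambda>n. ennreal (potential_density t) * ennreal (heat_kernel (s n + t) y)) \<longlonglongrightarrow> ennreal (potential_density t) * ennreal (heat_kernel t y)"
      proof (cases "t > 0")
        case True
        have st: "(\<lambda>n. s n + t) \<longlonglongrightarrow> t" using tendsto_add[OF s(3) tendsto_const[of t]] by simp
        have "(\<lambda>n. heat_kernel (s n + t) y) \<longlonglongrightarrow> heat_kernel t y"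
          unfolding heat_kernel_def using True by (intro tendsto_intros st) auto
        then show ?thesis by (intro tendsto_mult_ennreal tendsto_ennrealI tendsto_const) auto
      qed (simp add: potential_density_nonpos)
    qed
  qed measurable
  have "(\<integral>\<^sup>+t. indicator {0<..} t * ennreal (Q 0 t y) \<partial>lborel) =
     (\<integral>\<^sup>+t. liminf (\<lambda>n. indicator {0<..} t * ennreal (Q (s n) t y)) \<partial>lborel)"
  proof (rule nn_integral_cong)
    fix t :: real
    have "(\<lambda>n. indicator {0<..} t * ennreal (Q (s n) t y)) \<longlonglongrightarrow> indicator {0<..} t * ennreal (Q 0 t y)"
    proof (cases "t > 0")
      case True
      then show ?thesis
        by (intro tendsto_mult_ennreal tendsto_ennrealI tendsto_const Q_tendsto_fst s) auto
    qed simp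
    then show "indicator {0<..} t * ennreal (Q 0 t y) = liminf (\<lambda>n. indicator {0<..} t * ennreal (Q (s n) t y))"
      by (rule lim_imp_Liminf[OF sequentially_bot, symmetric])
  qed
  also have "\<dots> \<le> liminf (\<lambda>n. \<integral>\<^sup>+t. indicator {0<..} t * ennreal (Q (s n) t y) \<partial>lborel)"
    by (rule nn_integral_liminf) measurable
  also have "\<dots> = (\<integral>\<^sup>+t. ennreal (potential_density t) * ennreal (heat_kernel t y) \<partial>lborel)"
    unfolding heat_kernel_s by (rule lim_imp_Liminf[OF sequentially_bot lim])
  finally show "(\<integral>\<^sup>+t. indicator {0<..} t * ennreal (Q 0 t y) \<partial>lborel) \<le>
    (\<integral>\<^sup>+t. ennreal (potential_density t) * ennreal (heat_kernel t y) \<partial>lborel)" .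
  \<comment> \<open>The reverse inequality regularises in time, with \<open>s n\<close> as the
    starting time of the time integral.\<close>
  have "(\<integral>\<^sup>+t. ennreal (potential_density t) * ennreal (heat_kernel t y) \<partial>lborel) =
     (\<integral>\<^sup>+t. liminf (\<lambda>n. ennreal (potential_density t) * ennreal (Q (0 + t) (s n) y)) \<partial>lborel)"
  proof (rule nn_integral_cong)
    fix t :: real
    have "(\<lambda>n. ennreal (potential_density t) * ennreal (Q (0 + t) (s n) y)) \<longlonglongrightarrow> ennreal (potential_density t) * ennreal (heat_kernel t y)"
    proof (cases "t > 0")
      case True
      have "(\<lambda>n. Q (0 + t) (s n) y) \<longlonglongrightarrow> heat_kernel t y"
        using Q_tendsto_snd[OF True s(2,3), of y] Q_0[OF True, of y] by simp
      then show ?thesis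
        by (intro tendsto_mult_ennreal tendsto_ennrealI tendsto_const) auto
    qed (simp add: potential_density_nonpos)
    then show "ennreal (potential_density t) * ennreal (heat_kernel t y) = liminf (\<lambda>n. ennreal (potential_density t) * ennreal (Q (0 + t) (s n) y))"
      by (rule lim_imp_Liminf[OF sequentially_bot, symmetric])
  qed
  also have "\<dots> \<le> liminf (\<lambda>n. \<integral>\<^sup>+t. ennreal (potential_density t) * ennreal (Q (0 + t) (s n) y) \<partial>lborel)"
    by (rule nn_integral_liminf) simp
  also have "\<dots> \<le> liminf (\<lambda>n. \<integral>\<^sup>+t. indicator {0<..} t * ennreal (Q 0 t y) \<partial>lborel)"
  proof (intro Liminf_mono always_eventually allI)
    fix n
    have "(\<integral>\<^sup>+t. ennreal (potential_density t) * ennreal (Q (0 + t) (s n) y) \<partial>lborel) =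
       (\<integral>\<^sup>+t. indicator {0<..} t * ennreal (Q 0 (s n + t) y) \<partial>lborel)"
      using integrable_exp_inverse[OF d s(1)[of n]] s(1)[of n] by (intro nn_integral_Q_eq Qnn) auto
    \<comment> \<open>Enlarging the range to \<open>t > - s n\<close> makes it a translate of the
      whole half-line: a time integral started at \<open>s n\<close> is at most the full
      one.\<close>
    also have "\<dots> \<le> (\<integral>\<^sup>+t. indicator {0<..} (s n + t) * ennreal (Q 0 (s n + t) y) \<partial>lborel)"
      using s(1)[of n] by (intro nn_integral_mono) (auto split: split_indicator)
    also have "\<dots> = (\<integral>\<^sup>+t. indicator {0<..} t * ennreal (Q 0 t y) \<partial>lborel)"
      by (subst nn_integral_real_affine[where c=1 and t="s n" and f="\<lambda>t. indicator {0<..} t * ennreal (Q 0 t y)"]) auto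
    finally show "(\<integral>\<^sup>+t. ennreal (potential_density t) * ennreal (Q (0 + t) (s n) y) \<partial>lborel) \<le>
        (\<integral>\<^sup>+t. indicator {0<..} t * ennreal (Q 0 t y) \<partial>lborel)" .
  qed
  also have "\<dots> = (\<integral>\<^sup>+t. indicator {0<..} t * ennreal (Q 0 t y) \<partial>lborel)"
    by (rule Liminf_const) simp
  finally show "(\<integral>\<^sup>+t. ennreal (potential_density t) * ennreal (heat_kernel t y) \<partial>lborel) \<le>
     (\<integral>\<^sup>+t. indicator {0<..} t * ennreal (Q 0 t y) \<partial>lborel)" .
qed

lemma continuous_on_karamata_test:
  assumes a: "a > (0::real)"
  shows "continuous_on {0..1} (\<lambda>z. if z \<ge> 1 then 0 else (1 - 1 / ln z) powr a * exp (1 / (4 * ln z)))"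
    (is "continuous_on _ ?v")
proof -
  have 0: "((\<lambda>z. (1 - 1 / ln z) powr a * exp (1 / (4 * ln z))) \<longlongrightarrow> 1) (at_right 0)"
    using a by real_asymp
  have 1: "((\<lambda>z. (1 - 1 / ln z) powr a * exp (1 / (4 * ln z))) \<longlongrightarrow> 0) (at_left 1)"
    using a by real_asymp
  show ?thesis
    unfolding continuous_on_eq_continuous_within
  proof
    fix z :: real assume z: "z \<in> {0..1}"
    consider "z = 0" | "z = 1" | "0 < z" "z < 1" using z by fastforce
    then show "continuous (at z within {0..1}) ?v"
    proof cases
      case 1
      have "(?v \<longlongrightarrow> 1) (at_right 0)"
      proof (rule Lim_transform_eventually[OF 0])
        show "\<forall>\<^sub>F z in at_right 0. (1 - 1 / ln z) powr a * exp (1 / (4 * ln z)) = ?v z"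
          using order_tendstoD(2)[OF tendsto_ident_at[of "0::real" "{0<..}"], of 1]
          by (auto elim!: eventually_mono)
      qed
      then show ?thesis using 1 by (simp add: continuous_within at_within_Icc_at_right)
    next
      case 2
      have "(?v \<longlongrightarrow> 0) (at_left 1)"
      proof (rule Lim_transform_eventually[OF 1])
        have "\<forall>\<^sub>F z in at_left (1::real). z < 1" by (simp add: eventually_at_filter)
        then show "\<forall>\<^sub>F z in at_left 1. (1 - 1 / ln z) powr a * exp (1 / (4 * ln z)) = ?v z"
          by eventually_elim simp
      qed
      then show ?thesis using 2 by (simp add: continuous_within at_within_Icc_at_left)
    next
      case 3
      have ln: "ln z < 0" using 3 by simp
      have "isCont (\<lambda>z. (1 - 1 / ln z) powr a * exp (1 / (4 * ln z))) z"
      proof (intro continuous_intros)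
        show "1 - 1 / ln z \<noteq> 0" using ln by (simp add: field_simps)
      qed (use 3 ln in auto)
      moreover have "\<forall>\<^sub>F w in nhds z. (1 - 1 / ln w) powr a * exp (1 / (4 * ln w)) = ?v w"
        using eventually_nhds_in_open[of "{..<1}" z] 3 by (auto elim: eventually_mono)
      ultimately have "isCont ?v z" by (simp only: isCont_cong)
      then show ?thesis by (rule continuous_at_imp_continuous_at_within)
    qed
  qed
qed

text \<open>The substitution \<open>t = 1 / (4 * x)\<close> gives
  \<open>(pi / t) powr a = (4 * pi * x) powr a\<close> and the Jacobian
  \<open>1 / (4 * x\<^sup>2)\<close>, leaving the Gamma integral with power
  \<open>x powr (a - 2)\<close>.\<close>

lemma nn_integral_heat_kernel_kernel:
  assumes a: "a > (1::real)"
  shows "(\<integral>\<^sup>+t. indicator {0<..} t * ennreal ((pi / t) powr a * exp (- (1 / (4 * t)))) \<partial>lborel)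
     = ennreal ((4 * pi) powr a * Gamma (a - 1) / 4)"
proof -
  define f where "f t = (pi / t) powr a * exp (- (1 / (4 * t)))" for t :: real
  define h where "h x = (4 * pi) powr a / 4 * (x powr ((a - 1) - 1) * exp (- (1 * x)))" for x :: real
  have nn_h: "(\<integral>\<^sup>+x. ennreal (h x * indicator {0<..} x) \<partial>lborel) = ennreal ((4 * pi) powr a * Gamma (a - 1) / 4)"
  proof -
    have "(\<integral>\<^sup>+x. ennreal (h x * indicator {0<..} x) \<partial>lborel) =
      (\<integral>\<^sup>+x. ennreal ((4 * pi) powr a / 4) * (ennreal (x powr ((a - 1) - 1) * exp (- (1 * x))) * indicator {0<..} x) \<partial>lborel)"
      by (intro nn_integral_cong) (auto simp: h_def ennreal_mult'[symmetric] split: split_indicator)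
    also have "\<dots> = ennreal ((4 * pi) powr a / 4) * ennreal (Gamma (a - 1) * 1 powr (- (a - 1)))"
      using a by (subst nn_integral_cmult) (simp_all only: nn_integral_Gamma_scaled, auto)
    finally show ?thesis by (simp add: ennreal_mult'[symmetric])
  qed
  have h_int: "set_integrable lborel {0<..} h"
    unfolding set_integrable_def
    by (rule integrableI_nonneg) (use nn_h in \<open>auto simp: h_def mult.commute\<close>)
  have h_val: "(LINT x:{0<..}|lborel. h x) = (4 * pi) powr a * Gamma (a - 1) / 4"
    unfolding set_lebesgue_integral_def
    using nn_h a by (subst integral_eq_nn_integral) (auto simp: h_def mult.commute Gamma_real_nonneg)
  have habs: "h absolutely_integrable_on {0<..}" and hint: "integral {0<..} h = (4 * pi) powr a * Gamma (a - 1) / 4"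
    using h_int h_val set_borel_integral_eq_integral[OF h_int] by (auto simp: set_integrable_def integrable_completion)
  have subst: "\<bar>- 1 / (4 * x\<^sup>2)\<bar> * f (1 / (4 * x)) = h x" if "x > 0" for x
  proof -
    have "f (1 / (4 * x)) = (4 * pi) powr a * x powr a * exp (- x)"
      using that by (simp add: f_def powr_mult mult_ac)
    moreover have "x powr ((a - 1) - 1) = x powr a / x\<^sup>2"
    proof -
      have "x powr (a - 2) = x powr a / x powr 2" by (rule powr_diff)
      then show ?thesis using that by simp
    qed
    ultimately show ?thesis by (simp add: h_def)
  qed
  have img: "(\<lambda>x. 1 / (4 * x)) ` {0<..} = ({0<..} :: real set)"
  proof (intro equalityI subsetI)
    fix x :: real assume "x \<in> {0<..}"
    then show "x \<in> (\<lambda>x. 1 / (4 * x)) ` {0<..}" by (intro image_eqI[of _ _ "1 / (4 * x)"]) auto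
  qed auto
  have "(\<lambda>x. \<bar>- 1 / (4 * x\<^sup>2)\<bar> * f (1 / (4 * x))) absolutely_integrable_on {0<..} \<and>
      integral {0<..} (\<lambda>x. \<bar>- 1 / (4 * x\<^sup>2)\<bar> * f (1 / (4 * x))) = (4 * pi) powr a * Gamma (a - 1) / 4
     \<longleftrightarrow> f absolutely_integrable_on ((\<lambda>x. 1 / (4 * x)) ` {0<..}) \<and>
       integral ((\<lambda>x. 1 / (4 * x)) ` {0<..}) f = (4 * pi) powr a * Gamma (a - 1) / 4"
    by (rule has_absolute_integral_change_of_variables_1')
       (auto intro!: derivative_eq_intros inj_onI simp: power2_eq_square field_simps)
  moreover have "(\<lambda>x. \<bar>- 1 / (4 * x\<^sup>2)\<bar> * f (1 / (4 * x))) absolutely_integrable_on {0<..}"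
    using habs by (rule absolutely_integrable_spike[OF _ negligible_empty]) (use subst in auto)
  moreover have "integral {0<..} (\<lambda>x. \<bar>- 1 / (4 * x\<^sup>2)\<bar> * f (1 / (4 * x))) = (4 * pi) powr a * Gamma (a - 1) / 4"
    unfolding hint[symmetric] by (intro Henstock_Kurzweil_Integration.integral_cong subst) auto
  ultimately have f: "f absolutely_integrable_on {0<..}" "integral {0<..} f = (4 * pi) powr a * Gamma (a - 1) / 4"
    unfolding img by auto
  have fi: "(f has_integral ((4 * pi) powr a * Gamma (a - 1) / 4)) {0<..}"
    using f set_lebesgue_integral_eq_integral(1)[OF f(1)] by (metis integrable_integral)
  have "(\<integral>\<^sup>+t. ennreal (indicator {0<..} t * f t) \<partial>lborel) = ennreal ((4 * pi) powr a * Gamma (a - 1) / 4)"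
    by (rule nn_integral_has_integral_lebesgue[OF _ fi]) (simp add: f_def)
  then show ?thesis
    by (simp add: f_def ennreal_mult' ennreal_indicator)
qed

section \<open>Asymptotics\<close>

text \<open>For \<open>a = d / 2\<close> this is \<open>(2 * pi) ^ d\<close> times the Green
  function at distance \<open>r\<close>, since \<open>heat_kernel\<close> is normalised with that
  factor.\<close>

definition green_kernel :: "real \<Rightarrow> real \<Rightarrow> real" where
  "green_kernel a r = enn2real (\<integral>\<^sup>+t. ennreal (potential_density t) * ennreal ((pi / t) powr a * exp (- (r\<^sup>2 / (4 * t)))) \<partial>lborel)"

text \<open>Rescaling time by \<open>(r n)\<^sup>2\<close> frees the kernel of \<open>r n\<close>
  and leaves the rescaled potential densities. Their Laplace transforms tend to
  \<open>1 / q\<close>, that of Lebesgue measure on the half-line, so Karamata's theorem gives the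
  limit.\<close>

lemma green_kernel_tendsto_sequentially:
  assumes a: "a > 1" and r: "\<And>n. r n > 0"
    and lim: "\<And>q. q > 0 \<Longrightarrow> (\<lambda>n. \<phi> (1 / (r n)\<^sup>2) / \<phi> (q * (1 / (r n)\<^sup>2))) \<longlonglongrightarrow> 1 / q"
  shows "(\<lambda>n. r n powr (2 * a) * \<phi> (1 / (r n)\<^sup>2) * green_kernel a (r n)) \<longlonglongrightarrow> (4 * pi) powr a * Gamma (a - 1) / 4"
proof -
  \<comment> \<open>Designed so that the weight times \<open>v (exp (- t))\<close> is the kernel at
    distance 1.\<close>
  define v where "v z = pi powr a * (if z \<ge> 1 then 0 else (1 - 1 / ln z) powr a * exp (1 / (4 * ln z)))" for z :: real
  have v_cont: "continuous_on {0..1} v"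
    unfolding v_def using a by (intro continuous_intros continuous_on_karamata_test) auto
  have [measurable]: "v \<in> borel_measurable borel"
    unfolding v_def[abs_def] by measurable
  have v_eq: "(1 + t) powr (- a) * v (exp (- t)) = (pi / t) powr a * exp (- (1 / (4 * t)))" if "t > 0" for t
  proof -
    have "1 + 1 / t = (1 + t) / t" using that by (simp add: field_simps)
    then have "(1 + 1 / t) powr a * (1 + t) powr (- a) = 1 / t powr a"
      using that by (simp add: powr_divide powr_minus field_simps)
    moreover have "(1 + t) powr (- a) * v (exp (- t)) =
        pi powr a * ((1 + 1 / t) powr a * (1 + t) powr (- a)) * exp (- (1 / (4 * t)))"
      using that by (simp add: v_def mult_ac)
    ultimately show ?thesis
      using that by (simp add: powr_divide)
  qed
  have v_nonneg: "v z \<ge> 0" for z by (simp add: v_def)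
  define f where "f n t = ennreal ((r n)\<^sup>2 * \<phi> (1 / (r n)\<^sup>2) * potential_density ((r n)\<^sup>2 * t))" for n t
  have r2: "(r n)\<^sup>2 > 0" for n using r[of n] by simp
  have f_bd: "laplace_bounded (f n)" for n
    unfolding f_def by (rule laplace_bounded_potential_density[OF r2])
  have g_lap: "laplace (\<lambda>t. indicator {0<..} t) q = ennreal (1 / q)" if "q > 0" for q
    using nn_integral_exp_pos[OF that] by (simp add: laplace_def)
  have g_bd: "laplace_bounded (\<lambda>t. indicator {0<..} t)"
    unfolding laplace_bounded_def by (auto simp: g_lap ennreal_leI simp del: ennreal_plus)
  have int_eq: "(\<integral>t. (1 + t) powr (- a) * v (exp (- t)) \<partial>density lborel h) =
      enn2real (\<integral>\<^sup>+t. h t * ennreal ((pi / t) powr a * exp (- (1 / (4 * t)))) \<partial>lborel)"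
    if h: "laplace_bounded h" for h
  proof -
    have [measurable]: "h \<in> borel_measurable borel" using h by (simp add: laplace_bounded_def)
    have "(\<integral>t. (1 + t) powr (- a) * v (exp (- t)) \<partial>density lborel h) =
       enn2real (\<integral>\<^sup>+t. ennreal ((1 + t) powr (- a) * v (exp (- t))) \<partial>density lborel h)"
      by (intro integral_eq_nn_integral) (auto simp: v_nonneg)
    also have "(\<integral>\<^sup>+t. ennreal ((1 + t) powr (- a) * v (exp (- t))) \<partial>density lborel h) =
       (\<integral>\<^sup>+t. h t * ennreal ((1 + t) powr (- a) * v (exp (- t))) \<partial>lborel)"
      by (rule nn_integral_density) measurable
    also have "\<dots> = (\<integral>\<^sup>+t. h t * ennreal ((pi / t) powr a * exp (- (1 / (4 * t)))) \<partial>lborel)"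
    proof (rule nn_integral_cong)
      fix t :: real
      show "h t * ennreal ((1 + t) powr (- a) * v (exp (- t))) = h t * ennreal ((pi / t) powr a * exp (- (1 / (4 * t))))"
        using h v_eq[of t] by (cases "t > 0") (auto simp: laplace_bounded_def)
    qed
    finally show ?thesis .
  qed
  have green_kernel_eq: "enn2real (\<integral>\<^sup>+t. f n t * ennreal ((pi / t) powr a * exp (- (1 / (4 * t)))) \<partial>lborel) =
     r n powr (2 * a) * \<phi> (1 / (r n)\<^sup>2) * green_kernel a (r n)" for n
  proof -
    define T where "T = (r n)\<^sup>2"
    have T: "T > 0" using r2 by (simp add: T_def)
    have pos: "\<phi> (1 / T) > 0" using T by (intro phi_pos) auto
    have Ta: "T powr a = r n powr (2 * a)"
      using r[of n] by (simp add: T_def powr_powr[symmetric])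
    have "(\<integral>\<^sup>+t. ennreal (potential_density t) * ennreal ((pi / t) powr a * exp (- (T / (4 * t)))) \<partial>lborel) =
       ennreal T * (\<integral>\<^sup>+t. ennreal (potential_density (T * t)) * ennreal ((pi / (T * t)) powr a * exp (- (T / (4 * (T * t))))) \<partial>lborel)"
      using T by (subst nn_integral_real_affine[where c=T and t=0]) auto
    then have "ennreal (T powr a * \<phi> (1 / T)) * (\<integral>\<^sup>+t. ennreal (potential_density t) * ennreal ((pi / t) powr a * exp (- (T / (4 * t)))) \<partial>lborel) =
       (\<integral>\<^sup>+t. ennreal (T powr a * \<phi> (1 / T)) * (ennreal T * (ennreal (potential_density (T * t)) * ennreal ((pi / (T * t)) powr a * exp (- (T / (4 * (T * t))))))) \<partial>lborel)"
      by (simp add: nn_integral_cmult)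
    also have "\<dots> = (\<integral>\<^sup>+t. f n t * ennreal ((pi / t) powr a * exp (- (1 / (4 * t)))) \<partial>lborel)"
    proof (rule nn_integral_cong)
      fix t :: real
      show "ennreal (T powr a * \<phi> (1 / T)) * (ennreal T * (ennreal (potential_density (T * t)) * ennreal ((pi / (T * t)) powr a * exp (- (T / (4 * (T * t))))))) =
        f n t * ennreal ((pi / t) powr a * exp (- (1 / (4 * t))))"
      proof (cases "t > 0")
        case True
        have "T powr a * ((pi / (T * t)) powr a * exp (- (T / (4 * (T * t))))) = (pi / t) powr a * exp (- (1 / (4 * t)))"
          using T True by (simp add: powr_divide powr_mult)
        moreover have flip_eq: "A * B * (T * (C * E)) = T * B * C * (A * E)" for A B C E :: real
          by (simp only: mult_ac)
        ultimately have "T powr a * \<phi> (1 / T) * (T * (potential_density (T * t) * ((pi / (T * t)) powr a * exp (- (T / (4 * (T * t))))))) =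
          T * \<phi> (1 / T) * potential_density (T * t) * ((pi / t) powr a * exp (- (1 / (4 * t))))"
          by (simp only: flip_eq)
        then show ?thesis
          using T pos unfolding f_def T_def[symmetric] by (simp only: ennreal_mult[symmetric] potential_density_nonneg mult_nonneg_nonneg less_imp_le powr_ge_zero exp_ge_zero)
      next
        case False
        then have "T * t \<le> 0" using T by (simp add: mult_nonneg_nonpos)
        then show ?thesis by (simp add: f_def potential_density_nonpos T_def)
      qed
    qed
    finally have "enn2real (\<integral>\<^sup>+t. f n t * ennreal ((pi / t) powr a * exp (- (1 / (4 * t)))) \<partial>lborel) =
       enn2real (ennreal (T powr a * \<phi> (1 / T)) * (\<integral>\<^sup>+t. ennreal (potential_density t) * ennreal ((pi / t) powr a * exp (- (T / (4 * t)))) \<partial>lborel))"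
      by simp
    also have "\<dots> = T powr a * \<phi> (1 / T) * green_kernel a (r n)"
      using pos by (simp add: enn2real_mult green_kernel_def T_def)
    finally show ?thesis unfolding Ta unfolding T_def .
  qed
  have "(\<lambda>n. \<integral>t. (1 + t) powr (- a) * v (exp (- t)) \<partial>density lborel (f n)) \<longlonglongrightarrow>
     (\<integral>t. (1 + t) powr (- a) * v (exp (- t)) \<partial>density lborel (\<lambda>t. indicator {0<..} t))"
  proof (rule karamata[OF f_bd g_bd a _ v_cont])
    fix q :: real assume q: "q > 0"
    show "(\<lambda>n. laplace (f n) q) \<longlonglongrightarrow> laplace (\<lambda>t. indicator {0<..} t) q"
      unfolding f_def laplace_potential_density_scaled[OF r2 q] g_lap[OF q] by (intro tendsto_ennrealI lim q)
  qed measurable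
  moreover have "enn2real (\<integral>\<^sup>+t. indicator {0<..} t * ennreal ((pi / t) powr a * exp (- (1 / (4 * t)))) \<partial>lborel) =
     (4 * pi) powr a * Gamma (a - 1) / 4"
    unfolding nn_integral_heat_kernel_kernel[OF a] using a by (intro enn2real_ennreal) (auto intro!: Gamma_real_nonneg)
  ultimately show ?thesis
    unfolding int_eq[OF f_bd] int_eq[OF g_bd] green_kernel_eq by simp
qed

lemma green_kernel_tendsto_at_right_0:
  assumes a: "a > 1"
  shows "((\<lambda>r. r powr (2 * a) * \<phi> (1 / r\<^sup>2) * green_kernel a r) \<longlongrightarrow> (4 * pi) powr a * Gamma (a - 1) / 4) (at_right 0)"
  unfolding tendsto_at_iff_sequentially comp_def
proof (intro allI impI)
  fix X :: "nat \<Rightarrow> real" assume X: "\<forall>i. X i \<in> {0<..} - {0}" "X \<longlonglongrightarrow> 0"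
  have "X n > 0" "X n \<noteq> 0" for n
    using X(1) by (auto dest: spec[of _ n])
  then have "filterlim X (at_right 0) sequentially"
    using X(2) by (auto simp: filterlim_at intro!: always_eventually)
  moreover have "filterlim (\<lambda>x::real. 1 / x\<^sup>2) at_top (at_right 0)" by real_asymp
  ultimately have F: "filterlim (\<lambda>n. 1 / (X n)\<^sup>2) at_top sequentially"
    by (rule filterlim_compose[rotated])
  show "(\<lambda>n. X n powr (2 * a) * \<phi> (1 / (X n)\<^sup>2) * green_kernel a (X n)) \<longlonglongrightarrow> (4 * pi) powr a * Gamma (a - 1) / 4"
    using X by (intro green_kernel_tendsto_sequentially a filterlim_compose[OF phi_ratio_at_top F]) auto
qed

lemma green_kernel_tendsto_at_top:
  assumes a: "a > 1"
  shows "((\<lambda>r. r powr (2 * a) * \<phi> (1 / r\<^sup>2) * green_kernel a r) \<longlongrightarrow> (4 * pi) powr a * Gamma (a - 1) / 4) at_top"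
proof (rule tendsto_at_topI_sequentially)
  fix X :: "nat \<Rightarrow> real" assume X: "filterlim X at_top sequentially"
  \<comment> \<open>The sequential statement wants every term positive, so finitely many terms are
    dropped.\<close>
  obtain N where N: "\<And>n. n \<ge> N \<Longrightarrow> X n > 0"
    using filterlim_at_top_dense[THEN iffD1, OF X, rule_format, of 0] by (auto simp: eventually_sequentially)
  have "filterlim (\<lambda>n. X (n + N)) at_top sequentially"
    using filterlim_compose[OF X filterlim_add_const_nat_at_top] .
  moreover have "filterlim (\<lambda>x::real. 1 / x\<^sup>2) (at_right 0) at_top" by real_asymp
  ultimately have F: "filterlim (\<lambda>n. 1 / (X (n + N))\<^sup>2) (at_right 0) sequentially"
    by (rule filterlim_compose[rotated])
  have "(\<lambda>n. X (n + N) powr (2 * a) * \<phi> (1 / (X (n + N))\<^sup>2) * green_kernel a (X (n + N))) \<longlonglongrightarrow> (4 * pi) powr a * Gamma (a - 1) / 4"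
    using N by (intro green_kernel_tendsto_sequentially a filterlim_compose[OF phi_ratio_at_right_0 F]) auto
  then show "(\<lambda>n. X n powr (2 * a) * \<phi> (1 / (X n)\<^sup>2) * green_kernel a (X n)) \<longlonglongrightarrow> (4 * pi) powr a * Gamma (a - 1) / 4"
    by (rule LIMSEQ_offset)
qed

text \<open>The process supplies two facts to the analytic identity: \<open>Q\<close> is
  nonnegative, being an expectation of heat kernels or a limit of such, and the continuous
  transition density equals \<open>Q 0 t\<close> up to \<open>(2 * pi) ^ d\<close> at every
  point.\<close>

lemma green_function_eq:
  fixes M :: "'w measure" and X :: "real \<Rightarrow> 'w \<Rightarrow> 'a::euclidean_space"
  assumes d: "DIM('a) \<ge> 3" and levy: "levy_process M X"
    and char: "has_char_exponent M X (\<lambda>\<xi>. complex_of_real (log_exponent \<xi>))"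
    and dens: "transition_density M X p"
    and y: "y \<noteq> 0"
  shows "ennreal ((2 * pi) ^ DIM('a)) * green_function p 0 y =
    (\<integral>\<^sup>+t. ennreal (potential_density t) * ennreal (heat_kernel t y) \<partial>lborel)"
proof -
  define c where "c = (2 * pi) ^ DIM('a)"
  have c: "c > 0" by (simp add: c_def)
  interpret prob_space M using levy by (simp add: levy_process_def)
  have X [measurable]: "X t \<in> borel_measurable M" if "t \<ge> 0" for t
    using levy that by (simp add: levy_process_def)
  have X0: "AE \<omega> in M. X 0 \<omega> = 0" using levy by (simp add: levy_process_def)
  have Q_expectation: "(\<integral>\<omega>. heat_kernel s (y - (X t \<omega> - X 0 \<omega>)) \<partial>M) = Q s t y" if s: "s > 0" and t: "t \<ge> 0" for s t and y :: 'a
  proof -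
    have "(\<lambda>\<omega>. X t \<omega> - X 0 \<omega>) \<in> borel_measurable M"
      using X[OF t] X[of 0] by simp
    moreover have "(CLINT \<omega>|M. iexp (\<xi> \<bullet> (X t \<omega> - X 0 \<omega>))) = complex_of_real (exp (- (t * log_exponent \<xi>)))" for \<xi>
      using char t by (simp add: has_char_exponent_def exp_of_real[symmetric])
    ultimately show ?thesis
      unfolding Q_def using s by (intro expectation_heat_kernel prob_space_axioms)
  qed
  have Q_nonneg_pos: "Q s t y \<ge> 0" if "s > 0" "t \<ge> 0" for s t and y :: 'a
    unfolding Q_expectation[OF that, symmetric] by (intro Bochner_Integration.integral_nonneg heat_kernel_nonneg)
  define s where "s n = 1 / real (Suc n)" for n
  have s: "s n > 0" "s n \<ge> 0" "s \<longlonglongrightarrow> 0" for n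
    unfolding s_def using LIMSEQ_inverse_real_of_nat by (auto simp: inverse_eq_divide)
  have Q_nonneg: "Q s t y \<ge> 0" if "s \<ge> 0" "t \<ge> 0" "s + t > 0" for s t and y :: 'a
  proof (cases "s > 0")
    case False
    then have [simp]: "s = 0" and t: "t > 0" using that by auto
    show ?thesis
    proof (rule LIMSEQ_le_const)
      show "(\<lambda>n. Q (1 / real (Suc n)) t y) \<longlonglongrightarrow> Q s t y"
        using Q_tendsto_fst[OF t, of "\<lambda>n. 1 / real (Suc n)" y] LIMSEQ_inverse_real_of_nat by (simp add: inverse_eq_divide)
      show "\<exists>N. \<forall>n\<ge>N. 0 \<le> Q (1 / real (Suc n)) t y"
        using t by (intro exI allI impI Q_nonneg_pos) auto
    qed
  qed (use that Q_nonneg_pos in auto)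
  have p_eq: "c * p t 0 y = Q 0 t y" if t: "t > 0" for t and y :: 'a
    unfolding c_def
  proof (rule continuous_density_eq_limit[where s=s and k="\<lambda>n. Q (s n) t" and B="Q 0 t (0::'a)"])
    show "continuous_on UNIV (p t 0)" "\<And>z. p t 0 z \<ge> 0"
      using dens t by (auto simp: transition_density_def)
    have D: "distributed M lborel (\<lambda>\<omega>. 0 + X t \<omega>) (\<lambda>y. ennreal (p t 0 y))"
      using dens t unfolding transition_density_def by blast
    show "(\<integral>\<^sup>+z. ennreal (p t 0 z) * ennreal (heat_kernel (s n) (y - z)) \<partial>lborel) = ennreal (Q (s n) t y)" for n y
    proof -
      have "(\<integral>\<^sup>+z. ennreal (p t 0 z) * ennreal (heat_kernel (s n) (y - z)) \<partial>lborel) = (\<integral>\<^sup>+\<omega>. ennreal (heat_kernel (s n) (y - (0 + X t \<omega>))) \<partial>M)"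
        by (rule distributed_nn_integral[OF D]) measurable
      also have "\<dots> = (\<integral>\<^sup>+\<omega>. ennreal (heat_kernel (s n) (y - (X t \<omega> - X 0 \<omega>))) \<partial>M)"
        using X0 by (intro nn_integral_cong_AE) (auto elim!: eventually_mono)
      also have "\<dots> = ennreal (\<integral>\<omega>. heat_kernel (s n) (y - (X t \<omega> - X 0 \<omega>)) \<partial>M)"
      proof (rule nn_integral_eq_integral)
        show "integrable M (\<lambda>\<omega>. heat_kernel (s n) (y - (X t \<omega> - X 0 \<omega>)))"
        proof (rule integrable_const_bound[where B="(pi / s n) powr (real DIM('a) / 2)"])
          show "AE \<omega> in M. norm (heat_kernel (s n) (y - (X t \<omega> - X 0 \<omega>))) \<le> (pi / s n) powr (real DIM('a) / 2)"
            using s(1)[of n] by (intro AE_I2) (auto simp: heat_kernel_def intro!: mult_left_le)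
        qed (use X[of t] X[of 0] t in simp)
      qed (simp add: heat_kernel_nonneg)
      finally show ?thesis using Q_expectation[OF s(1)] t by simp
    qed
    show "(\<lambda>n. Q (s n) t y) \<longlonglongrightarrow> Q 0 t y" for y :: 'a
      by (rule Q_tendsto_fst[OF t s(2,3)])
    show "Q 0 t y \<le> Q 0 t (0::'a)" for y :: 'a by (rule Q_le_Q_0[OF t])
    show "Q 0 t y \<ge> 0" for y :: 'a using t by (intro Q_nonneg) auto
  qed (rule s)+
  have "ennreal c * green_function p 0 y = ennreal c * (\<integral>\<^sup>+t. indicator {0<..} t * ennreal (Q 0 t y / c) \<partial>lborel)"
  proof -
    have "p t 0 y = Q 0 t y / c" if "t > 0" for t
      using p_eq[OF that, of y] c by (simp add: field_simps)
    then have "ennreal (p t 0 y) * indicator {0<..} t = indicator {0<..} t * ennreal (Q 0 t y / c)" for t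
      by (simp split: split_indicator)
    then show ?thesis unfolding green_function_def by (simp only:)
  qed
  also have "\<dots> = (\<integral>\<^sup>+t. ennreal c * (indicator {0<..} t * ennreal (Q 0 t y / c)) \<partial>lborel)"
    by (rule nn_integral_cmult[symmetric]) measurable
  also have "\<dots> = (\<integral>\<^sup>+t. indicator {0<..} t * ennreal (Q 0 t y) \<partial>lborel)"
    using c by (intro nn_integral_cong) (auto split: split_indicator simp: ennreal_mult'[symmetric])
  also have "\<dots> = (\<integral>\<^sup>+t. ennreal (potential_density t) * ennreal (heat_kernel t y) \<partial>lborel)"
    by (rule nn_integral_Q_eq_potential[OF d y Q_nonneg])
  finally show ?thesis by (simp add: c_def)
qed

theorem proposition2p3:
  fixes M :: "'w measure"
    and X :: "real \<Rightarrow> 'w \<Rightarrow> 'a::euclidean_space"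
    and p :: "real \<Rightarrow> 'a \<Rightarrow> 'a \<Rightarrow> real"
    and g :: "real \<Rightarrow> real"
  assumes "DIM('a) \<ge> 3"
    and "levy_process M X"
    and "has_char_exponent M X (\<lambda>\<xi>. complex_of_real (log_exponent \<xi>))"
    and "transition_density M X p"
    and "\<And>x y. x \<noteq> y \<Longrightarrow> green_function p x y = ennreal (g (norm (x - y)))"
  shows "(g \<sim>[at_right 0]
           (\<lambda>r. Gamma (real DIM('a) / 2 - 1) / (2 * pi powr (real DIM('a) / 2))
                  * r powr (2 - real DIM('a)) * ln (1 / r)))
       \<and> (g \<sim>[at_top]
           (\<lambda>r. Gamma (real DIM('a) / 2 - 1) / (2 * pi powr (real DIM('a) / 2))
                  * r powr (2 - real DIM('a))))"
proof
  define a where "a = real DIM('a) / 2"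
  have a: "a > 1" using assms(1) by (simp add: a_def)
  have G: "Gamma (a - 1) > 0" using a by (intro Gamma_real_pos) auto
  define c :: real where "c = (2 * pi) ^ DIM('a)"
  have c: "c > 0" by (simp add: c_def)
  define L where "L = (4 * pi) powr a * Gamma (a - 1) / 4"
  have L: "L > 0" using G by (simp add: L_def)
  \<comment> \<open>\<open>(2 * pi) ^ d\<close> splits as
    \<open>(4 * pi) powr a * pi powr a\<close>, and the first factor cancels against
    \<open>L\<close>.\<close>
  have Lc: "L / c = Gamma (a - 1) / (4 * pi powr a)"
  proof -
    have "c = (2 * pi) powr (2 * a)" by (simp add: c_def a_def powr_realpow)
    also have "\<dots> = ((2 * pi) powr 2) powr a" by (simp only: powr_powr)
    also have "(2 * pi) powr 2 = (4 * pi) * pi" by (simp add: power2_eq_square)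
    also have "((4 * pi) * pi) powr a = (4 * pi) powr a * pi powr a" by (rule powr_mult)
    finally show ?thesis by (simp add: L_def)
  qed
  \<comment> \<open>\<open>ennreal\<close> truncates negative numbers to 0, so at this point only
    the positive part of \<open>g r\<close> is determined.\<close>
  have max_g: "c * max 0 (g r) = green_kernel a r" if r: "r > 0" for r
  proof -
    obtain b :: 'a where b: "b \<in> Basis" using nonempty_Basis by blast
    define y where "y = r *\<^sub>R b"
    have y: "y \<noteq> 0" "norm y = r" using r b by (auto simp: y_def nonzero_Basis)
    have "ennreal c * green_function p 0 y = (\<integral>\<^sup>+t. ennreal (potential_density t) * ennreal (heat_kernel t y) \<partial>lborel)"
      unfolding c_def by (rule green_function_eq[OF assms(1-4) y(1)])
    also have "green_function p 0 y = ennreal (g r)"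
      using assms(5)[of 0 y] y by simp
    finally have "green_kernel a r = enn2real (ennreal c * ennreal (g r))"
      by (simp add: green_kernel_def heat_kernel_def a_def y(2))
    then show ?thesis using c by (simp add: enn2real_mult max_def ennreal_neg)
  qed
  \<comment> \<open>The limit \<open>L\<close> is positive, so \<open>green_kernel a r\<close> is
    eventually nonzero; this excludes the truncated case and recovers \<open>g r\<close>
    itself.\<close>
  have g_eq: "\<forall>\<^sub>F r in F. g r = green_kernel a r / c"
    if F: "((\<lambda>r. r powr (2 * a) * \<phi> (1 / r\<^sup>2) * green_kernel a r) \<longlongrightarrow> L) F" and F0: "\<forall>\<^sub>F r in F. r > 0" for F
    using order_tendstoD(1)[OF F L] F0
  proof eventually_elim
    case (elim r)
    then have "green_kernel a r \<noteq> 0" by auto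
    then have "max 0 (g r) \<noteq> 0" using max_g[OF elim(2)] by auto
    then have "g r > 0" by (cases "g r > 0") auto
    then show ?case using max_g[OF elim(2)] c by (simp add: field_simps)
  qed
  \<comment> \<open>One argument for both regimes: \<open>w\<close> is the logarithmic correction or
    1, and the limit 2 turns the denominator \<open>4 * pi powr a\<close> of \<open>L / c\<close>
    into \<open>2 * pi powr a\<close>.\<close>
  have conv: "g \<sim>[F] (\<lambda>r. Gamma (a - 1) / (2 * pi powr a) * r powr (2 - 2 * a) * w r)"
    if F: "((\<lambda>r. r powr (2 * a) * \<phi> (1 / r\<^sup>2) * green_kernel a r) \<longlongrightarrow> L) F" and F0: "\<forall>\<^sub>F r in F. r > 0"
      and w: "((\<lambda>r. 1 / (r\<^sup>2 * \<phi> (1 / r\<^sup>2) * w r)) \<longlongrightarrow> 2) F" for F w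
  proof (rule asymp_equivI')
    have "((\<lambda>r. r powr (2 * a) * \<phi> (1 / r\<^sup>2) * green_kernel a r * (1 / (r\<^sup>2 * \<phi> (1 / r\<^sup>2) * w r)) / (c * (2 * (L / c)))) \<longlongrightarrow> L * 2 / (c * (2 * (L / c)))) F"
      using c L by (intro tendsto_intros F w) auto
    moreover have "L * 2 / (c * (2 * (L / c))) = 1" using c L by simp
    moreover have "\<forall>\<^sub>F r in F. r powr (2 * a) * \<phi> (1 / r\<^sup>2) * green_kernel a r * (1 / (r\<^sup>2 * \<phi> (1 / r\<^sup>2) * w r)) / (c * (2 * (L / c))) =
        g r / (Gamma (a - 1) / (2 * pi powr a) * r powr (2 - 2 * a) * w r)"
      using F0 g_eq[OF F F0]
    proof eventually_elim
      case (elim r)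
      have "\<phi> (1 / r\<^sup>2) > 0" using elim by (intro phi_pos) auto
      moreover have "r powr (2 - 2 * a) = r\<^sup>2 / r powr (2 * a)"
        using elim by (simp add: powr_diff)
      moreover have "2 * (L / c) = Gamma (a - 1) / (2 * pi powr a)" unfolding Lc by simp
      ultimately show ?case
        using elim by (simp add: mult_ac)
    qed
    ultimately show "((\<lambda>r. g r / (Gamma (a - 1) / (2 * pi powr a) * r powr (2 - 2 * a) * w r)) \<longlongrightarrow> 1) F"
      by (auto elim: Lim_transform_eventually)
  qed
  have D: "real DIM('a) / 2 = a" "real DIM('a) = 2 * a" by (simp_all add: a_def)
  have w0: "((\<lambda>r. 1 / (r\<^sup>2 * \<phi> (1 / r\<^sup>2) * ln (1 / r))) \<longlongrightarrow> 2) (at_right 0)"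
    unfolding \<phi>_def by real_asymp
  have w1: "((\<lambda>r. 1 / (r\<^sup>2 * \<phi> (1 / r\<^sup>2) * 1)) \<longlongrightarrow> 2) at_top"
    unfolding \<phi>_def by real_asymp
  show "g \<sim>[at_right 0] (\<lambda>r. Gamma (real DIM('a) / 2 - 1) / (2 * pi powr (real DIM('a) / 2))
                  * r powr (2 - real DIM('a)) * ln (1 / r))"
    unfolding D(1) unfolding D(2)
    using green_kernel_tendsto_at_right_0[OF a] by (intro conv w0) (auto simp: L_def eventually_at_right_less)
  show "g \<sim>[at_top] (\<lambda>r. Gamma (real DIM('a) / 2 - 1) / (2 * pi powr (real DIM('a) / 2))
                  * r powr (2 - real DIM('a)))"
    unfolding D(1) unfolding D(2)
    using conv[OF _ _ w1] green_kernel_tendsto_at_top[OF a] by (simp add: L_def eventually_gt_at_top)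
qed

end
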